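(* Let $R,C,T,k,V_{\mathrm{meas}}>0$, $\tau=RC$, $\sigma=2kTR/V_{\mathrm{meas}}$, and consider $$\tau\,dv=(-v+R\,i)\,dt+\sqrt{2kTR}\,dB,\qquad dY=\frac{v}{\sqrt{V_{\mathrm{meas}}}}\,dt+dB_{\mathrm{meas}},\qquad Y(0)=0,$$ where $v(0)\sim N(0,kT/C)$, $B$ and $B_{\mathrm{meas}}$ are standard Brownian motions, and $v(0),B,B_{\mathrm{meas}}$ are independent. Let $T_{\min}$ solve $$\tau\dot T_{\min}=2(T-T_{\min})-\frac{\sigma T_{\min}^2}{2T},\qquad T_{\min}(0)=T.$$ For $0\le G<\infty$ let the control be $i(t)=-G\hat v(t)$, where $\hat v$ is the Kalman-Bucy estimate given by $$\tau\,d\hat v=(-\hat v+R\,i)\,dt+\frac{\sigma T_{\min}}{2T}\big(\sqrt{V_{\mathrm{meas}}}\,dY-\hat v\,dt\big),\qquad \hat v(0)=0.$$ Let $T_C(t)=\frac{C}{k}\langle v(t)^2\rangle$ be the effective temperature and $W(t)=-\int_0^t\langle v(t')i(t')\rangle\,dt'$ the extracted work under this control. Then for every $t\ge0$, as $G\to\infty$, $T_C(t)$ decreases to $T_{\min}(t)$, and $W(t)$ converges to $$W_{\max}(t)=\int_0^t\frac{k}{\tau}\big(T-T_{\min}(t')\big)\,dt'+\frac12k\big(T-T_{\min}(t)\big).$$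
   Context: $\langle\cdot\rangle$ denotes expectation. The system is the rigorous form of the Langevin equation $\tau\dot v=-v+Ri+\sqrt{2kTR}\,w$ with noisy measurement $v_{\mathrm{meas}}=v+\sqrt{V_{\mathrm{meas}}}\,w_{\mathrm{meas}}$, $w,w_{\mathrm{meas}}$ independent Gaussian white noises; formally $v_{\mathrm{meas}}=\sqrt{V_{\mathrm{meas}}}\,dY/dt$. "Decreases" means that $T_C(t)$ is non-increasing as a function of $G$ for each fixed $t$. *)

theory Defs
  imports "HOL-Probability.Probability"
begin

text \<open>Stochastic processes are functions \<open>X :: real \<Rightarrow> 'a \<Rightarrow> real\<close> of which only the times
  \<open>t \<ge> 0\<close> matter.\<close>

definition brownian_motion :: "'a measure \<Rightarrow> (real \<Rightarrow> 'a \<Rightarrow> real) \<Rightarrow> bool" where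
  "brownian_motion M B \<longleftrightarrow>
     prob_space M \<and>
     (\<forall>t\<ge>0. B t \<in> borel_measurable M) \<and>
     (AE \<omega> in M. B 0 \<omega> = 0) \<and>
     (AE \<omega> in M. continuous_on {0..} (\<lambda>t. B t \<omega>)) \<and>
     (\<forall>s t. 0 \<le> s \<and> s < t \<longrightarrow>
        distributed M lborel (\<lambda>\<omega>. B t \<omega> - B s \<omega>) (normal_density 0 (sqrt (t - s)))) \<and>
     (\<forall>(n::nat) s. 0 \<le> s 0 \<and> (\<forall>j<n. s j \<le> s (Suc j)) \<longrightarrow>
        prob_space.indep_vars M (\<lambda>_. borel) (\<lambda>j \<omega>. B (s (Suc j)) \<omega> - B (s j) \<omega>) {..<n})"

definition process_algebra :: "'a measure \<Rightarrow> (real \<Rightarrow> 'a \<Rightarrow> real) \<Rightarrow> 'a set set" where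
  "process_algebra M X =
     sigma_sets (space M) {X t -` A \<inter> space M | t A. 0 \<le> t \<and> A \<in> sets borel}"

definition partition_of :: "real \<Rightarrow> nat \<Rightarrow> (nat \<Rightarrow> real) \<Rightarrow> bool" where
  "partition_of t n s \<longleftrightarrow> s 0 = 0 \<and> s n = t \<and> (\<forall>j<n. s j \<le> s (Suc j))"

text \<open>\<open>stochastic_integral M h X J\<close>: \<open>J\<close> is a continuous version of the Ito integral process
  \<open>J t = \<integral>\<^sub>0\<^sup>t h dX\<close> of a deterministic continuous integrand \<open>h\<close> against a continuous
  semimartingale \<open>X\<close>. For such an integrand the integral is the limit in probability of the
  left-endpoint Riemann sums as the mesh of the partition tends to zero.\<close>

definition stochastic_integral ::
  "'a measure \<Rightarrow> (real \<Rightarrow> real) \<Rightarrow> (real \<Rightarrow> 'a \<Rightarrow> real) \<Rightarrow> (real \<Rightarrow> 'a \<Rightarrow> real) \<Rightarrow> bool" where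
  "stochastic_integral M h X J \<longleftrightarrow>
     (\<forall>t\<ge>0. J t \<in> borel_measurable M) \<and>
     (AE \<omega> in M. continuous_on {0..} (\<lambda>t. J t \<omega>)) \<and>
     (\<forall>t\<ge>0. \<forall>\<epsilon>>0. \<exists>\<delta>>0. \<forall>n s. partition_of t n s \<and> (\<forall>j<n. s (Suc j) - s j < \<delta>) \<longrightarrow>
        measure M {\<omega> \<in> space M.
          \<epsilon> < \<bar>(\<Sum>j<n. h (s j) * (X (s (Suc j)) \<omega> - X (s j) \<omega>)) - J t \<omega>\<bar>} < \<epsilon>)"

text \<open>\<open>stochastic_diff M X a N\<close>: \<open>X\<close> is a continuous process with \<open>dX = a dt + dN\<close>. By linearity of the
  differential, a constant factor \<open>c\<close> in \<open>c dX\<close> or \<open>c dN\<close> is expressed by multiplying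
  the process by \<open>c\<close>.\<close>

definition stochastic_diff ::
  "'a measure \<Rightarrow> (real \<Rightarrow> 'a \<Rightarrow> real) \<Rightarrow> (real \<Rightarrow> 'a \<Rightarrow> real) \<Rightarrow> (real \<Rightarrow> 'a \<Rightarrow> real) \<Rightarrow> bool" where
  "stochastic_diff M X a N \<longleftrightarrow>
     (\<forall>t\<ge>0. X t \<in> borel_measurable M) \<and>
     (AE \<omega> in M. continuous_on {0..} (\<lambda>t. X t \<omega>)) \<and>
     (AE \<omega> in M. \<forall>t\<ge>0.
        ((\<lambda>s. a s \<omega>) has_integral (X t \<omega> - X 0 \<omega>) - (N t \<omega> - N 0 \<omega>)) {0..t})"

end

theory Submission
  imports Defs
begin

text \<open>Write \<open>e = v - vhat\<close>. The feedback cancels in the linear equation for \<open>e\<close>, and with integrating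
  factors both \<open>e t\<close> and \<open>vhat t\<close> become, pathwise, Wiener integrals of \<open>C\<^sup>1\<close> kernels against the
  three independent sources \<open>v0\<close>, \<open>B\<close>, \<open>Bmeas\<close>. The Ito isometry for such kernels reduces all second
  moments to integrals of kernel products, and the Riccati equation turns these integrands into
  exact derivatives: \<open>\<langle>e\<^sup>2\<rangle> = k Tmin / C\<close>, \<open>\<langle>e vhat\<rangle> = 0\<close> and \<open>\<langle>vhat\<^sup>2\<rangle> = Q\<close>, where
  \<open>Q G t = \<integral>\<^sub>0\<^sup>t exp (-2 c G (t - s)) q s ds\<close> with \<open>c G = (1 + R G) / \<tau>\<close> and \<open>q \<ge> 0\<close> independent of \<open>G\<close>.
  Hence \<open>TC = Tmin + (C / k) Q\<close>, which is antitone in \<open>G\<close>, and the extracted power is \<open>G Q\<close>; integrating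
  \<open>Q' = q - 2 c Q\<close> gives \<open>W = G (\<integral>q - Q) / (2 c G)\<close> and thus the limit.\<close>

section \<open>Wiener integrals of smooth kernels\<close>

text \<open>The stochastic integral in the filter equation is given only as a limit in probability
  of Riemann sums, and Brownian paths have unbounded variation. Pathwise reasoning survives because
  every integrand here is \<open>C1_halfline\<close>: integration by parts moves the differential
  onto the integrand, so the sums converge on each continuous path and the equations can be solved
  by integrating factors, one path at a time. Functions are carried with an explicit derivative,
  one-sided at 0, because that derivative enters the integral itself. Solving for the estimate nests
  integrals: the error is itself a Wiener integral and drives \<open>vhat\<close>. A primitive
  \<open>K G\<close> of the coupling flattens this to kernels with the factor
  \<open>K G t - K G s\<close>, and the choice of gain makes the resulting covariance integrands
  telescope. Behind the outcome is the innovation picture: up to second moments, \<open>vhat\<close>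
  relaxes at rate \<open>c G\<close> under white noise whose strength does not depend on the
  feedback. Strong feedback suppresses \<open>Q\<close>, but the power \<open>G * Q\<close> stays
  bounded because \<open>c G\<close> grows linearly in \<open>G\<close>.\<close>

definition C1_halfline :: "(real \<Rightarrow> real) \<Rightarrow> (real \<Rightarrow> real) \<Rightarrow> bool" where
  "C1_halfline f f' \<longleftrightarrow>
     (\<forall>s\<ge>0. (f has_real_derivative f' s) (at s within {0..})) \<and> continuous_on {0..} f'"

lemma C1_halflineD:
  assumes "C1_halfline f f'"
  shows "\<And>s. s \<ge> 0 \<Longrightarrow> (f has_real_derivative f' s) (at s within {0..})" "continuous_on {0..} f'"
  using assms by (auto simp: C1_halfline_def)

lemma C1_halfline_continuous:
  assumes "C1_halfline f f'"
  shows "continuous_on {0..} f"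
  using assms
  by (auto simp: C1_halfline_def continuous_on_eq_continuous_within intro!: DERIV_continuous)

lemma continuous_on_halfline_Icc:
  assumes "continuous_on {0..} f"
  shows "continuous_on {0..t::real} f"
  by (rule continuous_on_subset[OF assms]) auto

lemma integrable_on_halfline_Icc:
  fixes f :: "real \<Rightarrow> real"
  assumes "continuous_on {0..} f"
  shows "f integrable_on {0..t}"
  by (rule integrable_continuous_real[OF continuous_on_halfline_Icc[OF assms]])

lemma C1_halfline_FTC:
  assumes "C1_halfline f f'" "0 \<le> t"
  shows "(f' has_integral f t - f 0) {0..t}"
proof (rule fundamental_theorem_of_calculus[OF assms(2)])
  fix x assume "x \<in> {0..t}"
  then have "(f has_real_derivative f' x) (at x within {0..})"
    using C1_halflineD[OF assms(1)] by auto
  then have "(f has_real_derivative f' x) (at x within {0..t})"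
    by (rule DERIV_subset) auto
  then show "(f has_vector_derivative f' x) (at x within {0..t})"
    by (simp add: has_real_derivative_iff_has_vector_derivative)
qed

lemma C1_halfline_integral:
  assumes "continuous_on {0..} q"
  shows "C1_halfline (\<lambda>t. integral {0..t} q) q"
  unfolding C1_halfline_def
proof (intro conjI allI impI assms)
  fix s :: real assume s: "0 \<le> s"
  \<comment> \<open>Differentiability is local: near \<open>s\<close> the half-line may be exchanged
    for a compact interval, on which the integral of a continuous function is known to be
    differentiable.\<close>
  have *: "at s within {0..} = at s within {0..s+1}"
    by (rule at_within_nhd[where S="{..<s+1}"]) auto
  show "((\<lambda>t. integral {0..t} q) has_real_derivative q s) (at s within {0..})"
    unfolding * using s
    by (intro integral_has_real_derivative continuous_on_subset[OF assms]) auto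
qed

lemma C1_halfline_const: "C1_halfline (\<lambda>_. c) (\<lambda>_. 0)"
  by (auto simp: C1_halfline_def)

lemma C1_halfline_add:
  assumes "C1_halfline f f'" "C1_halfline g g'"
  shows "C1_halfline (\<lambda>t. f t + g t) (\<lambda>t. f' t + g' t)"
  using assms by (auto simp: C1_halfline_def intro!: DERIV_add continuous_intros)

lemma C1_halfline_diff:
  assumes "C1_halfline f f'" "C1_halfline g g'"
  shows "C1_halfline (\<lambda>t. f t - g t) (\<lambda>t. f' t - g' t)"
  using assms by (auto simp: C1_halfline_def intro!: DERIV_diff continuous_intros)

lemma C1_halfline_mult:
  assumes f: "C1_halfline f f'" and g: "C1_halfline g g'"
  shows "C1_halfline (\<lambda>t. f t * g t) (\<lambda>t. f' t * g t + f t * g' t)"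
  unfolding C1_halfline_def
proof (intro conjI allI impI)
  show "((\<lambda>t. f t * g t) has_real_derivative f' s * g s + f s * g' s) (at s within {0..})"
    if "0 \<le> s" for s
    using DERIV_mult'[OF C1_halflineD(1)[OF f that] C1_halflineD(1)[OF g that]]
    by (simp add: add.commute)
  show "continuous_on {0..} (\<lambda>t. f' t * g t + f t * g' t)"
    by (intro continuous_intros C1_halflineD(2)[OF f] C1_halflineD(2)[OF g]
        C1_halfline_continuous[OF f] C1_halfline_continuous[OF g])
qed

lemma C1_halfline_cmult:
  assumes "C1_halfline f f'"
  shows "C1_halfline (\<lambda>t. c * f t) (\<lambda>t. c * f' t)"
  using assms by (auto simp: C1_halfline_def intro!: DERIV_cmult continuous_intros)

lemma C1_halfline_exp:
  assumes f: "C1_halfline f f'"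
  shows "C1_halfline (\<lambda>t. exp (f t)) (\<lambda>t. f' t * exp (f t))"
  unfolding C1_halfline_def
proof (intro conjI allI impI)
  show "((\<lambda>t. exp (f t)) has_real_derivative f' s * exp (f s)) (at s within {0..})"
    if "0 \<le> s" for s
    using DERIV_chain2[OF DERIV_exp C1_halflineD(1)[OF f that]] by (simp add: mult.commute)
  show "continuous_on {0..} (\<lambda>t. f' t * exp (f t))"
    by (intro continuous_intros C1_halflineD(2)[OF f] C1_halfline_continuous[OF f])
qed

text \<open>Value and derivative are replaced together, so applying this rule leaves exactly the
  check that a computed derivative has the wanted closed form.\<close>

lemma C1_halfline_cong:
  assumes "C1_halfline f f'" "\<And>t. t \<ge> 0 \<Longrightarrow> f t = g t" "\<And>t. t \<ge> 0 \<Longrightarrow> f' t = g' t"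
  shows "C1_halfline g g'"
proof -
  have "continuous_on {0..} g'"
    using continuous_on_cong[of "{0..}" "{0..}" f' g'] C1_halflineD(2)[OF assms(1)] assms(3) by simp
  moreover have "(g has_real_derivative g' s) (at s within {0..})" if "s \<ge> 0" for s
  proof -
    have "(f has_real_derivative g' s) (at s within {0..})"
      using C1_halflineD(1)[OF assms(1) that] assms(3)[OF that] by simp
    then show ?thesis
      by (rule has_field_derivative_transform_within[where d=1]) (use that assms(2) in auto)
  qed
  ultimately show ?thesis by (auto simp: C1_halfline_def)
qed

lemma C1_halfline_by_parts:
  assumes "C1_halfline f f'" "C1_halfline g g'" "0 \<le> t"
  shows "integral {0..t} (\<lambda>s. f' s * g s) = f t * g t - f 0 * g 0 - integral {0..t} (\<lambda>s. f s * g' s)"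
proof -
  have c: "continuous_on {0..} (\<lambda>s. f' s * g s)" "continuous_on {0..} (\<lambda>s. f s * g' s)"
    using assms(1,2) C1_halfline_continuous[OF assms(1)] C1_halfline_continuous[OF assms(2)]
    by (auto simp: C1_halfline_def intro!: continuous_intros)
  have "((\<lambda>s. f' s * g s + f s * g' s) has_integral f t * g t - f 0 * g 0) {0..t}"
    by (rule C1_halfline_FTC[OF C1_halfline_mult[OF assms(1,2)] assms(3)])
  then have "integral {0..t} (\<lambda>s. f' s * g s + f s * g' s) = f t * g t - f 0 * g 0"
    by (rule integral_unique)
  moreover have "integral {0..t} (\<lambda>s. f' s * g s + f s * g' s)
      = integral {0..t} (\<lambda>s. f' s * g s) + integral {0..t} (\<lambda>s. f s * g' s)"
    by (intro Henstock_Kurzweil_Integration.integral_add integrable_on_halfline_Icc c)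
  ultimately show ?thesis by simp
qed

text \<open>The Wiener integral of a \<open>C\<^sup>1\<close> kernel \<open>f\<close> against a path \<open>x\<close>, with \<open>x 0 = 0\<close> understood: integration by
  parts makes it a pathwise expression.\<close>

definition wiener_int :: "(real \<Rightarrow> real) \<Rightarrow> (real \<Rightarrow> real) \<Rightarrow> (real \<Rightarrow> real) \<Rightarrow> real \<Rightarrow> real" where
  "wiener_int f f' x t = f t * x t - integral {0..t} (\<lambda>s. f' s * x s)"

lemma wiener_int_0 [simp]: "wiener_int f f' x 0 = f 0 * x 0"
  by (simp add: wiener_int_def)

lemma wiener_int_continuous:
  assumes "C1_halfline f f'" "continuous_on {0..} x"
  shows "continuous_on {0..} (wiener_int f f' x)"
proof -
  have "continuous_on {0..} (\<lambda>t. integral {0..t} (\<lambda>s. f' s * x s))"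
    by (rule C1_halfline_continuous[OF C1_halfline_integral])
      (use assms in \<open>auto simp: C1_halfline_def intro!: continuous_intros\<close>)
  then show ?thesis
    unfolding wiener_int_def using assms C1_halfline_continuous[OF assms(1)]
    by (auto intro!: continuous_intros)
qed

text \<open>Associativity, "if dz = g dx then f dz = f g dx". It holds for every continuous path
  because the product rule is only applied to the smooth factors \<open>f\<close>, \<open>g\<close>
  and \<open>U\<close>. It collapses the nested integrals that integrating factors produce.\<close>

lemma wiener_int_mult:
  assumes f: "C1_halfline f f'" and g: "C1_halfline g g'" and x: "continuous_on {0..} x" and t: "0 \<le> t"
  shows "wiener_int f f' (wiener_int g g' x) t = wiener_int (\<lambda>t. f t * g t) (\<lambda>t. f' t * g t + f t * g' t) x t"
proof -
  note cont = C1_halfline_continuous[OF f] C1_halfline_continuous[OF g]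
    C1_halflineD(2)[OF f] C1_halflineD(2)[OF g] x
  define U where "U = (\<lambda>t. integral {0..t} (\<lambda>s. g' s * x s))"
  have U: "C1_halfline U (\<lambda>s. g' s * x s)"
    unfolding U_def by (rule C1_halfline_integral) (intro continuous_intros cont)
  note cont = cont C1_halfline_continuous[OF U]
  have "integral {0..t} (\<lambda>s. f' s * wiener_int g g' x s)
      = integral {0..t} (\<lambda>s. f' s * g s * x s - f' s * U s)"
    by (simp add: wiener_int_def U_def algebra_simps)
  also have "\<dots> = integral {0..t} (\<lambda>s. f' s * g s * x s) - integral {0..t} (\<lambda>s. f' s * U s)"
    by (intro Henstock_Kurzweil_Integration.integral_diff integrable_on_halfline_Icc continuous_intros cont)
  also have "integral {0..t} (\<lambda>s. f' s * U s) = f t * U t - integral {0..t} (\<lambda>s. f s * (g' s * x s))"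
    using C1_halfline_by_parts[OF f U t] by (simp add: U_def)
  finally have 1: "integral {0..t} (\<lambda>s. f' s * wiener_int g g' x s) =
    integral {0..t} (\<lambda>s. f' s * g s * x s) - f t * U t + integral {0..t} (\<lambda>s. f s * (g' s * x s))" by simp
  have 2: "integral {0..t} (\<lambda>s. (f' s * g s + f s * g' s) * x s)
    = integral {0..t} (\<lambda>s. f' s * g s * x s) + integral {0..t} (\<lambda>s. f s * (g' s * x s))"
    by (subst Henstock_Kurzweil_Integration.integral_add[symmetric])
      (auto intro!: integrable_on_halfline_Icc continuous_intros cont simp: algebra_simps)
  show ?thesis
    unfolding wiener_int_def[of f] wiener_int_def[of "\<lambda>t. f t * g t"] 1 2 by (simp add: wiener_int_def U_def algebra_simps)
qed

lemma wiener_int_linear_path: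
  assumes f: "C1_halfline f f'" and x: "continuous_on {0..} x" and y: "continuous_on {0..} y"
  shows "wiener_int f f' (\<lambda>t. a * x t + b * y t) t = a * wiener_int f f' x t + b * wiener_int f f' y t"
proof -
  note cont = C1_halflineD(2)[OF f] x y
  have "integral {0..t} (\<lambda>s. f' s * (a * x s + b * y s))
     = integral {0..t} (\<lambda>s. a * (f' s * x s) + b * (f' s * y s))"
    by (simp add: algebra_simps)
  also have "\<dots> = integral {0..t} (\<lambda>s. a * (f' s * x s)) + integral {0..t} (\<lambda>s. b * (f' s * y s))"
    by (intro Henstock_Kurzweil_Integration.integral_add integrable_on_halfline_Icc continuous_intros cont)
  finally show ?thesis by (simp add: wiener_int_def algebra_simps)
qed

lemma wiener_int_linear_kernel:
  assumes f: "C1_halfline f f'" and g: "C1_halfline g g'" and x: "continuous_on {0..} x"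
  shows "wiener_int (\<lambda>t. a * f t + b * g t) (\<lambda>t. a * f' t + b * g' t) x t = a * wiener_int f f' x t + b * wiener_int g g' x t"
proof -
  note cont = C1_halflineD(2)[OF f] C1_halflineD(2)[OF g] x
  have "integral {0..t} (\<lambda>s. (a * f' s + b * g' s) * x s)
     = integral {0..t} (\<lambda>s. a * (f' s * x s) + b * (g' s * x s))"
    by (simp add: algebra_simps)
  also have "\<dots> = integral {0..t} (\<lambda>s. a * (f' s * x s)) + integral {0..t} (\<lambda>s. b * (g' s * x s))"
    by (intro Henstock_Kurzweil_Integration.integral_add integrable_on_halfline_Icc continuous_intros cont)
  finally show ?thesis by (simp add: wiener_int_def algebra_simps)
qed

lemma wiener_int_integral:
  assumes f: "C1_halfline f f'" and q: "continuous_on {0..} q" and t: "0 \<le> t"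
  shows "wiener_int f f' (\<lambda>t. integral {0..t} q) t = integral {0..t} (\<lambda>s. f s * q s)"
  using C1_halfline_by_parts[OF f C1_halfline_integral[OF q] t] by (simp add: wiener_int_def)

text \<open>Variation of constants: subtracting the rough term \<open>n\<close> leaves a \<open>C\<^sup>1\<close> path.\<close>

lemma linear_ode_with_noise:
  assumes E: "C1_halfline E (\<lambda>t. a t * E t)" "E 0 = 1"
    and a: "continuous_on {0..} a" and q: "continuous_on {0..} q" and n: "continuous_on {0..} n"
    and x: "continuous_on {0..} x"
    and eq: "\<And>t. 0 \<le> t \<Longrightarrow> ((\<lambda>s. - a s * x s + q s) has_integral x t - x0 - n t) {0..t}"
    and t: "0 \<le> t"
  shows "E t * x t = x0 + integral {0..t} (\<lambda>s. E s * q s) + wiener_int E (\<lambda>t. a t * E t) n t"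
proof -
  note cont = a q n x C1_halfline_continuous[OF E(1)]
  define y where "y = (\<lambda>t. x t - n t)"
  have y: "C1_halfline y (\<lambda>s. - a s * x s + q s)"
  proof (rule C1_halfline_cong[OF C1_halfline_add[OF C1_halfline_const[of x0] C1_halfline_integral]])
    show "continuous_on {0..} (\<lambda>s. - a s * x s + q s)"
      by (intro continuous_intros cont)
    show "x0 + integral {0..t} (\<lambda>s. - a s * x s + q s) = y t" if "0 \<le> t" for t
      using integral_unique[OF eq[OF that]] by (simp add: y_def)
  qed simp
  have "x 0 - x0 - n 0 = 0" 
    using integral_unique[OF eq[of 0]] by simp
  then have y0: "y 0 = x0" by (simp add: y_def)
  have "integral {0..t} (\<lambda>s. a s * E s * y s) = E t * y t - x0 - integral {0..t} (\<lambda>s. E s * (- a s * x s + q s))"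
    using C1_halfline_by_parts[OF E(1) y t] E(2) y0 by simp
  then have "E t * y t = x0 + (integral {0..t} (\<lambda>s. a s * E s * y s) + integral {0..t} (\<lambda>s. E s * (- a s * x s + q s)))"
    by simp
  also have "integral {0..t} (\<lambda>s. a s * E s * y s) + integral {0..t} (\<lambda>s. E s * (- a s * x s + q s))
     = integral {0..t} (\<lambda>s. E s * q s - a s * E s * n s)" 
    by (subst Henstock_Kurzweil_Integration.integral_add[symmetric])
      (auto intro!: integrable_on_halfline_Icc continuous_intros cont simp: y_def algebra_simps)
  also have "integral {0..t} (\<lambda>s. E s * q s - a s * E s * n s)
    = integral {0..t} (\<lambda>s. E s * q s) - integral {0..t} (\<lambda>s. a s * E s * n s)" 
    by (intro Henstock_Kurzweil_Integration.integral_diff integrable_on_halfline_Icc continuous_intros cont)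
  finally show ?thesis by (simp add: y_def wiener_int_def algebra_simps)
qed

section \<open>Stochastic integrals of smooth integrands\<close>

lemma sum_by_parts:
  fixes h y :: "nat \<Rightarrow> real"
  shows "(\<Sum>j<n. h j * (y (Suc j) - y j)) = h n * y n - h 0 * y 0 - (\<Sum>j<n. y (Suc j) * (h (Suc j) - h j))"
  by (induction n) (auto simp: algebra_simps)

lemma integral_sum_intervals:
  fixes f :: "real \<Rightarrow> real" and s :: "nat \<Rightarrow> real"
  assumes "continuous_on {0..} f" "s 0 = 0" "\<And>j. s j \<le> s (Suc j)"
  shows "integral {0..s n} f = (\<Sum>j<n. integral {s j..s (Suc j)} f)"
proof (induction n)
  case (Suc n)
  have "0 \<le> s n" using assms(2,3) by (induction n) (auto intro: order_trans)
  then have "integral {0..s n} f + integral {s n..s (Suc n)} f = integral {0..s (Suc n)} f"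
    using assms(3)[of n] integrable_on_halfline_Icc[OF assms(1)]
    by (intro Henstock_Kurzweil_Integration.integral_combine) auto
  then show ?case using Suc by simp
qed (simp add: assms)

lemma C1_halfline_FTC':
  assumes "C1_halfline f f'" "0 \<le> a" "a \<le> b"
  shows "integral {a..b} f' = f b - f a"
proof -
  have c: "f' integrable_on {0..b}" by (rule integrable_on_halfline_Icc[OF C1_halflineD(2)[OF assms(1)]])
  have "integral {0..a} f' + integral {a..b} f' = integral {0..b} f'"
    using assms c by (intro Henstock_Kurzweil_Integration.integral_combine) auto
  then show ?thesis
    using integral_unique[OF C1_halfline_FTC[OF assms(1), of a]]
      integral_unique[OF C1_halfline_FTC[OF assms(1), of b]] assms by simp
qed

text \<open>Summation by parts puts the increments on \<open>h\<close>, where they are integrals of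
  \<open>h'\<close>. On each cell the error is then \<open>h'\<close> against \<open>y x\<close>
  minus the right endpoint value of \<open>y\<close>, which uniform continuity of \<open>y\<close>
  controls. The term \<open>h 0 * y 0\<close> appears because \<open>wiener_int\<close> keeps only
  the boundary term at the upper end.\<close>

lemma left_sums_tendsto_wiener_int:
  assumes h: "C1_halfline h h'" and y: "continuous_on {0..} y" and t: "0 \<le> t"
  defines "s \<equiv> \<lambda>m j. t * real j / real (Suc m)"
  shows "(\<lambda>m. \<Sum>j<Suc m. h (s m j) * (y (s m (Suc j)) - y (s m j)))
           \<longlonglongrightarrow> wiener_int h h' y t - h 0 * y 0"
proof (rule LIMSEQ_I)
  fix r :: real assume r: "0 < r"
  have "bounded (h' ` {0..t})"
    by (intro compact_imp_bounded compact_continuous_image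
        continuous_on_halfline_Icc[OF C1_halflineD(2)[OF h]]) auto
  then obtain H where H: "H > 0" "\<And>x. x \<in> {0..t} \<Longrightarrow> \<bar>h' x\<bar> \<le> H"
    unfolding bounded_pos by auto
  \<comment> \<open>The total error will be at most \<open>H * t * e\<close>; the \<open>+ 1\<close>
    keeps the denominator positive when \<open>t = 0\<close>.\<close>
  define e where "e = r / (2 * (H * t + 1))"
  have Ht: "H * t + 1 > 0" using H t by (simp add: add_nonneg_pos)
  have e: "e > 0" using r Ht by (simp add: e_def)
  have "uniformly_continuous_on {0..t} y"
    by (intro compact_uniformly_continuous continuous_on_halfline_Icc y) auto
  then obtain d where d: "d > 0"
    "\<And>x x'. x \<in> {0..t} \<Longrightarrow> x' \<in> {0..t} \<Longrightarrow> dist x' x < d \<Longrightarrow> dist (y x') (y x) < e"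
    unfolding uniformly_continuous_on_def using e by metis
  obtain N where N: "real N > t / d" using reals_Archimedean2 by blast
  have "norm ((\<Sum>j<Suc m. h (s m j) * (y (s m (Suc j)) - y (s m j))) - (wiener_int h h' y t - h 0 * y 0)) < r"
    if m: "m \<ge> N" for m
  proof -
    have s0: "s m 0 = 0" and sn: "s m (Suc m) = t" by (simp_all add: s_def)
    have smono: "s m j \<le> s m (Suc j)" for j
      unfolding s_def using t by (intro divide_right_mono mult_left_mono) auto
    have sdiff: "s m (Suc j) - s m j = t / real (Suc m)" for j
      unfolding s_def by (simp add: diff_divide_distrib[symmetric] right_diff_distrib[symmetric])
    have "t / d < real (Suc m)" using N m by simp
    then have small: "t / real (Suc m) < d" using d(1) by (simp add: field_simps)
    have spos: "0 \<le> s m j" for j unfolding s_def using t by simp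
    have sle: "s m j \<le> t" if "j \<le> Suc m" for j
    proof -
      have "t * real j \<le> t * real (Suc m)" using that t by (intro mult_left_mono) auto
      then show ?thesis unfolding s_def by (simp add: field_simps)
    qed
    have hy: "continuous_on {0..} (\<lambda>x. h' x * y x)"
      by (intro continuous_intros C1_halflineD(2)[OF h] y)
    have int: "f integrable_on {s m j..s m (Suc j)}" if "continuous_on {0..} f" for f :: "real \<Rightarrow> real" and j
      by (intro integrable_continuous_real continuous_on_subset[OF that]) (use spos[of j] in auto)
    have "(\<Sum>j<Suc m. h (s m j) * (y (s m (Suc j)) - y (s m j))) - (wiener_int h h' y t - h 0 * y 0)
       = (\<Sum>j<Suc m. integral {s m j..s m (Suc j)} (\<lambda>x. h' x * y x) - y (s m (Suc j)) * (h (s m (Suc j)) - h (s m j)))"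
      unfolding sum_by_parts[of "\<lambda>j. h (s m j)" "\<lambda>j. y (s m j)"] s0 sn wiener_int_def sum_subtractf
      using integral_sum_intervals[OF hy, of "s m" "Suc m", OF s0 smono] sn by simp
    also have "\<dots> = (\<Sum>j<Suc m. integral {s m j..s m (Suc j)} (\<lambda>x. h' x * (y x - y (s m (Suc j)))))"
    proof (rule sum.cong[OF refl])
      fix j
      have "integral {s m j..s m (Suc j)} (\<lambda>x. h' x * (y x - y (s m (Suc j))))
         = integral {s m j..s m (Suc j)} (\<lambda>x. h' x * y x - y (s m (Suc j)) * h' x)"
        by (simp add: algebra_simps)
      also have "\<dots> = integral {s m j..s m (Suc j)} (\<lambda>x. h' x * y x) - integral {s m j..s m (Suc j)} (\<lambda>x. y (s m (Suc j)) * h' x)"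
        by (intro Henstock_Kurzweil_Integration.integral_diff int continuous_intros C1_halflineD(2)[OF h] y)
      finally show "integral {s m j..s m (Suc j)} (\<lambda>x. h' x * y x) - y (s m (Suc j)) * (h (s m (Suc j)) - h (s m j))
        = integral {s m j..s m (Suc j)} (\<lambda>x. h' x * (y x - y (s m (Suc j))))"
        using C1_halfline_FTC'[OF h spos smono, of j] by simp
    qed
    also have "norm \<dots> \<le> (\<Sum>j<Suc m. H * e * (t / real (Suc m)))"
    proof (rule sum_norm_le)
      fix j assume "j \<in> {..<Suc m}"
      then have j: "Suc j \<le> Suc m" by simp
      have "norm (integral {s m j..s m (Suc j)} (\<lambda>x. h' x * (y x - y (s m (Suc j))))) \<le> H * e * (s m (Suc j) - s m j)"
      proof (rule integral_bound[OF smono])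
        show "continuous_on {s m j..s m (Suc j)} (\<lambda>x. h' x * (y x - y (s m (Suc j))))"
          by (rule continuous_on_subset[of "{0..}"])
            (use spos[of j] in \<open>auto intro!: continuous_intros C1_halflineD(2)[OF h] y\<close>)
        fix x assume x: "x \<in> {s m j..s m (Suc j)}"
        then have x1: "x \<in> {0..t}" using spos[of j] sle[OF j] by auto
        have x2: "s m (Suc j) \<in> {0..t}" using spos[of "Suc j"] sle[OF j] by auto
        have "dist x (s m (Suc j)) < d" using x sdiff[of j] small by (auto simp: dist_real_def)
        then have "dist (y x) (y (s m (Suc j))) < e" by (rule d(2)[OF x2 x1])
        then have "\<bar>y x - y (s m (Suc j))\<bar> \<le> e" by (simp add: dist_real_def)
        then show "norm (h' x * (y x - y (s m (Suc j)))) \<le> H * e"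
          unfolding real_norm_def abs_mult using H(2)[OF x1] H(1) by (intro mult_mono) auto
      qed
      then show "norm (integral {s m j..s m (Suc j)} (\<lambda>x. h' x * (y x - y (s m (Suc j))))) \<le> H * e * (t / real (Suc m))"
        by (simp only: sdiff)
    qed
    also have "\<dots> = H * t * e" by (simp add: field_simps)
    also have "\<dots> < r"
    proof -
      have "H * t * e < (H * t + 1) * e" using e by (simp add: algebra_simps)
      also have "\<dots> = r / 2" unfolding e_def using Ht by (simp add: field_simps)
      finally show ?thesis using r by simp
    qed
    finally show ?thesis .
  qed
  then show "\<exists>no. \<forall>m\<ge>no. norm ((\<Sum>j<Suc m. h (s m j) * (y (s m (Suc j)) - y (s m j))) - (wiener_int h h' y t - h 0 * y 0)) < r"
    by blast
qed

text \<open>Almost sure identities can be collected over countably many times only; continuity then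
  extends them from the rational times to all times on one null set.\<close>

lemma continuous_on_halfline_eqI:
  fixes f g :: "real \<Rightarrow> real"
  assumes "continuous_on {0..} f" "continuous_on {0..} g" "\<And>q. q \<in> \<rat> \<Longrightarrow> 0 \<le> q \<Longrightarrow> f q = g q" "0 \<le> t"
  shows "f t = g t"
proof (rule ccontr)
  assume "f t \<noteq> g t"
  then have pos: "\<bar>f t - g t\<bar> > 0" by simp
  have "continuous_on {0..} (\<lambda>x. f x - g x)" by (intro continuous_intros assms)
  then obtain d where d: "d > 0" "\<And>x. x \<ge> 0 \<Longrightarrow> dist x t < d \<Longrightarrow> dist (f x - g x) (f t - g t) < \<bar>f t - g t\<bar>"
    unfolding continuous_on_iff using assms(4) pos by (metis atLeast_iff)
  obtain q where q: "q \<in> \<rat>" "t < q" "q < t + d" using Rats_dense_in_real[of t "t + d"] d by auto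
  have "dist q t < d" using q by (auto simp: dist_real_def)
  then have "dist (f q - g q) (f t - g t) < \<bar>f t - g t\<bar>" by (intro d) (use q assms(4) in auto)
  then show False using assms(3)[OF q(1)] q assms(4) by (auto simp: dist_real_def)
qed

text \<open>Along uniform partitions the Riemann sums converge both in probability (to \<open>J t\<close>) and
  pathwise (by summation by parts); a Borel--Cantelli subsequence identifies the limits.\<close>

lemma stochastic_integral_C1:
  assumes M: "prob_space M" and J: "stochastic_integral M h X J" and h: "C1_halfline h h'"
    and X[measurable]: "\<And>t. 0 \<le> t \<Longrightarrow> X t \<in> borel_measurable M"
    and cont: "AE \<omega> in M. continuous_on {0..} (\<lambda>t. X t \<omega>)"
  shows "AE \<omega> in M. \<forall>t\<ge>0. J t \<omega> = wiener_int h h' (\<lambda>s. X s \<omega>) t - h 0 * X 0 \<omega>"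
proof -
  interpret prob_space M by fact
  have 1: "AE \<omega> in M. J t \<omega> = wiener_int h h' (\<lambda>s. X s \<omega>) t - h 0 * X 0 \<omega>" if t: "0 \<le> t" for t
  proof -
    define s where "s = (\<lambda>m j. t * real j / real (Suc m))"
    define S where "S = (\<lambda>m \<omega>. \<Sum>j<Suc m. h (s m j) * (X (s m (Suc j)) \<omega> - X (s m j) \<omega>))"
    have spos: "0 \<le> s m j" for m j unfolding s_def using t by simp
    have Sm[measurable]: "S m \<in> borel_measurable M" for m
      unfolding S_def using spos by measurable
    have Jm[measurable]: "J t \<in> borel_measurable M" using J t by (auto simp: stochastic_integral_def)
    have part: "partition_of t (Suc m) (s m)" for m
      unfolding partition_of_def s_def using t
      by (auto intro!: divide_right_mono mult_left_mono)
    \<comment> \<open>The tolerance \<open>(1/2)^k\<close> serves twice: it bounds the exceptional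
      probabilities by a summable series and forces the deviations to zero. Demanding
      \<open>m \<ge> k\<close> makes the chosen indices tend to infinity.\<close>
    have ev: "\<exists>m. measure M {\<omega> \<in> space M. (1/2)^k < \<bar>S m \<omega> - J t \<omega>\<bar>} < (1/2)^k \<and> m \<ge> k" for k
    proof -
      have "0 < (1/2::real)^k" by simp
      then obtain \<delta> where \<delta>: "\<delta> > 0" "\<And>n s. partition_of t n s \<and> (\<forall>j<n. s (Suc j) - s j < \<delta>) \<Longrightarrow>
        measure M {\<omega> \<in> space M. (1/2)^k < \<bar>(\<Sum>j<n. h (s j) * (X (s (Suc j)) \<omega> - X (s j) \<omega>)) - J t \<omega>\<bar>} < (1/2)^k"
        using J t unfolding stochastic_integral_def by blast
      obtain N where N: "real N > t / \<delta>" using reals_Archimedean2 by blast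
      define m where "m = max N k"
      have "t / \<delta> < real (Suc m)" using N by (simp add: m_def)
      then have small: "t / real (Suc m) < \<delta>" using \<delta>(1) by (simp add: field_simps)
      have "s m (Suc j) - s m j = t / real (Suc m)" for j
        unfolding s_def by (simp add: diff_divide_distrib[symmetric] right_diff_distrib[symmetric])
      then show ?thesis
        using \<delta>(2)[of "Suc m" "s m"] part small unfolding S_def by (intro exI[of _ m]) (auto simp: m_def)
    qed
    then obtain \<phi> where \<phi>: "\<And>k. measure M {\<omega> \<in> space M. (1/2)^k < \<bar>S (\<phi> k) \<omega> - J t \<omega>\<bar>} < (1/2)^k" "\<And>k. \<phi> k \<ge> k"
      by metis
    have "AE \<omega> in M. eventually (\<lambda>k. \<omega> \<in> space M - {\<omega> \<in> space M. (1/2)^k < \<bar>S (\<phi> k) \<omega> - J t \<omega>\<bar>}) sequentially"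
    proof (rule borel_cantelli_AE1)
      show "summable (\<lambda>k. measure M {\<omega> \<in> space M. (1/2)^k < \<bar>S (\<phi> k) \<omega> - J t \<omega>\<bar>})"
        by (rule summable_comparison_test'[OF summable_geometric[of "1/2::real"], of 0])
          (use \<phi>(1) in \<open>auto intro: less_imp_le\<close>)
    qed (auto simp: less_top[symmetric])
    then show ?thesis using cont
    proof eventually_elim
      case (elim \<omega>)
      have lim: "filterlim \<phi> at_top sequentially"
        by (rule filterlim_at_top_mono[OF filterlim_ident]) (use \<phi>(2) in auto)
      have "(\<lambda>m. S m \<omega>) \<longlonglongrightarrow> wiener_int h h' (\<lambda>s. X s \<omega>) t - h 0 * X 0 \<omega>"
        unfolding S_def s_def by (rule left_sums_tendsto_wiener_int[OF h elim(2) t])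
      then have l1: "(\<lambda>k. S (\<phi> k) \<omega>) \<longlonglongrightarrow> wiener_int h h' (\<lambda>s. X s \<omega>) t - h 0 * X 0 \<omega>"
        by (rule filterlim_compose[OF _ lim])
      have "(\<lambda>k. S (\<phi> k) \<omega> - J t \<omega>) \<longlonglongrightarrow> 0"
      proof (rule Lim_null_comparison)
        show "\<forall>\<^sub>F k in sequentially. norm (S (\<phi> k) \<omega> - J t \<omega>) \<le> (1/2)^k"
          using elim(1) by eventually_elim auto
        show "(\<lambda>k. (1/2::real)^k) \<longlonglongrightarrow> 0" by (rule LIMSEQ_realpow_zero) auto
      qed
      then have "(\<lambda>k. S (\<phi> k) \<omega>) \<longlonglongrightarrow> J t \<omega>" by (rule LIM_zero_cancel)
      then show ?case using l1 by (rule LIMSEQ_unique)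
    qed
  qed
  have "AE \<omega> in M. \<forall>q\<in>\<rat>. 0 \<le> q \<longrightarrow> J q \<omega> = wiener_int h h' (\<lambda>s. X s \<omega>) q - h 0 * X 0 \<omega>"
    using 1 by (subst AE_ball_countable) (auto simp: countable_rat)
  moreover have "AE \<omega> in M. continuous_on {0..} (\<lambda>t. J t \<omega>)"
    using J by (auto simp: stochastic_integral_def)
  ultimately show ?thesis using cont
  proof eventually_elim
    case (elim \<omega>)
    have "continuous_on {0..} (\<lambda>t. wiener_int h h' (\<lambda>s. X s \<omega>) t - h 0 * X 0 \<omega>)"
      by (intro continuous_intros wiener_int_continuous[OF h elim(3)])
    then show ?case
      using continuous_on_halfline_eqI[OF elim(2)] elim(1) by blast
  qed
qed

section \<open>Covariance of Wiener integrals\<close>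

definition sq_integrable :: "'a measure \<Rightarrow> ('a \<Rightarrow> real) \<Rightarrow> bool" where
  "sq_integrable M \<xi> \<longleftrightarrow> \<xi> \<in> borel_measurable M \<and> integrable M (\<lambda>\<omega>. (\<xi> \<omega>)\<^sup>2)"

lemma sq_integrable_measurable [measurable_dest]: "sq_integrable M \<xi> \<Longrightarrow> \<xi> \<in> borel_measurable M"
  by (simp add: sq_integrable_def)

lemma abs_mult_le_sum_squares: "\<bar>a * b\<bar> \<le> a\<^sup>2 + (b::real)\<^sup>2"
proof -
  have "2 * \<bar>a\<bar> * \<bar>b\<bar> \<le> \<bar>a\<bar>\<^sup>2 + \<bar>b\<bar>\<^sup>2" by (rule sum_squares_bound)
  moreover have "0 \<le> \<bar>a\<bar> * \<bar>b\<bar>" by simp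
  ultimately show ?thesis unfolding abs_mult power2_abs by linarith
qed

lemma sq_integrable_mult:
  assumes "sq_integrable M \<xi>" "sq_integrable M \<eta>"
  shows "integrable M (\<lambda>\<omega>. \<xi> \<omega> * \<eta> \<omega>)"
proof (rule Bochner_Integration.integrable_bound)
  show "integrable M (\<lambda>\<omega>. (\<xi> \<omega>)\<^sup>2 + (\<eta> \<omega>)\<^sup>2)"
    using assms by (auto simp: sq_integrable_def)
  show "AE \<omega> in M. norm (\<xi> \<omega> * \<eta> \<omega>) \<le> norm ((\<xi> \<omega>)\<^sup>2 + (\<eta> \<omega>)\<^sup>2)"
    using abs_mult_le_sum_squares by (intro AE_I2) simp
qed (use assms in \<open>measurable\<close>)

lemma sq_integrable_add:
  assumes "sq_integrable M \<xi>" "sq_integrable M \<eta>"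
  shows "sq_integrable M (\<lambda>\<omega>. \<xi> \<omega> + \<eta> \<omega>)"
proof -
  have "integrable M (\<lambda>\<omega>. (\<xi> \<omega>)\<^sup>2 + (\<eta> \<omega>)\<^sup>2 + 2 * (\<xi> \<omega> * \<eta> \<omega>))"
    using assms sq_integrable_mult[OF assms]
    by (intro Bochner_Integration.integrable_add integrable_mult_right) (auto simp: sq_integrable_def)
  then show ?thesis
    using assms by (auto simp: sq_integrable_def power2_sum mult.assoc)
qed

lemma sq_integrable_cmult:
  assumes "sq_integrable M \<xi>"
  shows "sq_integrable M (\<lambda>\<omega>. c * \<xi> \<omega>)"
  using assms by (auto simp: sq_integrable_def power_mult_distrib)

text \<open>Cauchy-Schwarz against the constant 1, from expanding the nonnegative integral of
  \<open>(t * f s - I)\<^sup>2\<close> with \<open>I\<close> the integral of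
  \<open>f\<close>.\<close>

lemma integral_square_le:
  fixes f :: "real \<Rightarrow> real"
  assumes f: "continuous_on {0..} f" and t: "0 \<le> t"
  shows "(integral {0..t} f)\<^sup>2 \<le> t * integral {0..t} (\<lambda>s. (f s)\<^sup>2)"
proof (cases "t = 0")
  case False
  define I where "I = integral {0..t} f"
  have "0 \<le> integral {0..t} (\<lambda>s. (t * f s - I)\<^sup>2)"
    by (rule integral_nonneg) (auto intro!: integrable_on_halfline_Icc continuous_intros f)
  also have "\<dots> = integral {0..t} (\<lambda>s. (t\<^sup>2 * (f s)\<^sup>2 - (2 * t * I) * f s) + I\<^sup>2)"
    by (simp add: power2_diff power_mult_distrib algebra_simps)
  also have "\<dots> = integral {0..t} (\<lambda>s. t\<^sup>2 * (f s)\<^sup>2 - (2 * t * I) * f s) + integral {0..t} (\<lambda>s. I\<^sup>2)"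
    by (intro Henstock_Kurzweil_Integration.integral_add integrable_on_halfline_Icc continuous_intros f)
  also have "integral {0..t} (\<lambda>s. t\<^sup>2 * (f s)\<^sup>2 - (2 * t * I) * f s)
      = integral {0..t} (\<lambda>s. t\<^sup>2 * (f s)\<^sup>2) - integral {0..t} (\<lambda>s. (2 * t * I) * f s)"
    by (intro Henstock_Kurzweil_Integration.integral_diff integrable_on_halfline_Icc continuous_intros f)
  also have "integral {0..t} (\<lambda>s. t\<^sup>2 * (f s)\<^sup>2) - integral {0..t} (\<lambda>s. (2 * t * I) * f s) + integral {0..t} (\<lambda>s. I\<^sup>2)
     = t * (t * integral {0..t} (\<lambda>s. (f s)\<^sup>2) - I\<^sup>2)"
    using t by (simp add: I_def power2_eq_square algebra_simps)
  finally show ?thesis using False t by (simp add: I_def zero_le_mult_iff)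
qed simp

text \<open>Path integrals are Henstock-Kurzweil integrals; continuity of the paths identifies them
  with Lebesgue integrals, where Fubini applies. The uniform bound \<open>K\<close> on the absolute
  moments supplies integrability on the product space.\<close>

lemma Fubini_integral_Icc:
  fixes Z :: "real \<Rightarrow> 'a \<Rightarrow> real"
  assumes M: "prob_space M"
    and Zm: "(\<lambda>(s, \<omega>). Z s \<omega>) \<in> borel_measurable (lborel \<Otimes>\<^sub>M M)"
    and cont: "\<And>\<omega>. \<omega> \<in> space M \<Longrightarrow> continuous_on {0..} (\<lambda>s. Z s \<omega>)"
    and int: "\<And>s. s \<in> {0..t} \<Longrightarrow> integrable M (Z s)"
    and bound: "\<And>s. s \<in> {0..t} \<Longrightarrow> (\<integral>\<omega>. \<bar>Z s \<omega>\<bar> \<partial>M) \<le> K"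
  shows "integrable M (\<lambda>\<omega>. integral {0..t} (\<lambda>s. Z s \<omega>))" (is ?int)
    and "(\<integral>\<omega>. integral {0..t} (\<lambda>s. Z s \<omega>) \<partial>M) = integral {0..t} (\<lambda>s. \<integral>\<omega>. Z s \<omega> \<partial>M)" (is ?eq)
proof -
  interpret prob_space M by fact
  interpret P: pair_sigma_finite lborel M
    by (intro pair_sigma_finite.intro lborel.sigma_finite_measure_axioms sigma_finite_measure_axioms)
  note Zm[measurable]
  define Z0 where "Z0 = (\<lambda>s \<omega>. indicator {0..t} s *\<^sub>R Z s \<omega>)"
  have Z0m[measurable]: "(\<lambda>(s, \<omega>). Z0 s \<omega>) \<in> borel_measurable (lborel \<Otimes>\<^sub>M M)"
    unfolding Z0_def by measurable
  have "integrable (lborel \<Otimes>\<^sub>M M) (\<lambda>(s, \<omega>). Z0 s \<omega>)"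
  proof (rule P.Fubini_integrable[OF Z0m])
    show "AE s in lborel. integrable M (\<lambda>\<omega>. case (s, \<omega>) of (s, \<omega>) \<Rightarrow> Z0 s \<omega>)"
      using int by (auto simp: Z0_def indicator_def)
    show "integrable lborel (\<lambda>s. \<integral>\<omega>. norm (case (s, \<omega>) of (s, \<omega>) \<Rightarrow> Z0 s \<omega>) \<partial>M)"
    proof (rule Bochner_Integration.integrable_bound)
      show "integrable lborel (\<lambda>s. indicator {0..t} s * \<bar>K\<bar> :: real)"
        by (intro integrable_mult_left integrable_real_indicator) (auto simp: emeasure_lborel_Icc_eq)
      show "AE s in lborel. norm (\<integral>\<omega>. norm (case (s, \<omega>) of (s, \<omega>) \<Rightarrow> Z0 s \<omega>) \<partial>M)
          \<le> norm (indicator {0..t} s * \<bar>K\<bar>)"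
        using bound by (intro AE_I2) (force simp: Z0_def indicator_def)
    qed measurable
  qed
  note Zint = this
  have eq: "(\<integral>s. Z0 s \<omega> \<partial>lborel) = integral {0..t} (\<lambda>s. Z s \<omega>)" if "\<omega> \<in> space M" for \<omega>
    using set_borel_integral_eq_integral(2)[OF borel_integrable_atLeastAtMost'[OF
      continuous_on_halfline_Icc[OF cont[OF that]], of t]]
    by (simp add: set_lebesgue_integral_def Z0_def)
  have "integrable M (\<lambda>\<omega>. \<integral>s. Z0 s \<omega> \<partial>lborel)"
    using P.integrable_snd[OF Zint] by simp
  then show ?int
    using eq by (simp cong: Bochner_Integration.integrable_cong)
  have sint: "set_integrable lborel {0..t} (\<lambda>s. \<integral>\<omega>. Z s \<omega> \<partial>M)"
    using P.integrable_fst[OF Zint] by (simp add: Z0_def set_integrable_def)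
  have "(\<integral>\<omega>. integral {0..t} (\<lambda>s. Z s \<omega>) \<partial>M) = (\<integral>\<omega>. (\<integral>s. Z0 s \<omega> \<partial>lborel) \<partial>M)"
    using eq by (simp cong: Bochner_Integration.integral_cong)
  also have "\<dots> = (\<integral>s. (\<integral>\<omega>. Z0 s \<omega> \<partial>M) \<partial>lborel)"
    by (rule P.Fubini_integral[OF Zint])
  also have "\<dots> = integral {0..t} (\<lambda>s. \<integral>\<omega>. Z s \<omega> \<partial>M)"
    using set_borel_integral_eq_integral(2)[OF sint] by (simp add: Z0_def set_lebesgue_integral_def)
  finally show ?eq .
qed

text \<open>Continuity is asked of every path, not almost every one, and measurability jointly in
  time and chance, as the exchange of expectation and path integral uses both. Locally bounded
  second moments provide the dominating constants.\<close>

definition L2_process :: "'a measure \<Rightarrow> (real \<Rightarrow> 'a \<Rightarrow> real) \<Rightarrow> bool" where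
  "L2_process M X \<longleftrightarrow>
     (\<lambda>(s, \<omega>). X s \<omega>) \<in> borel_measurable (lborel \<Otimes>\<^sub>M M) \<and>
     (\<forall>\<omega>\<in>space M. continuous_on {0..} (\<lambda>s. X s \<omega>)) \<and>
     (\<forall>s\<ge>0. sq_integrable M (X s)) \<and>
     (\<forall>t. \<exists>K. \<forall>s\<in>{0..t}. (\<integral>\<omega>. (X s \<omega>)\<^sup>2 \<partial>M) \<le> K)"

context
  fixes M :: "'a measure" and X :: "real \<Rightarrow> 'a \<Rightarrow> real" and f f' :: "real \<Rightarrow> real" and t :: real
  assumes M: "prob_space M" and X: "L2_process M X" and f: "C1_halfline f f'" and t: "0 \<le> t"
begin

text \<open>Only the values of \<open>f'\<close> at nonnegative times are controlled. Composing with
  \<open>max 0\<close> extends it continuously to the line, which makes it Borel measurable.\<close>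

private lemma f'_ext:
  "(\<lambda>s. f' (max 0 s)) \<in> borel_measurable borel" "\<exists>C\<ge>0. \<forall>s\<in>{0..t}. \<bar>f' s\<bar> \<le> C"
proof -
  have "continuous_on UNIV (\<lambda>s. f' (max 0 s))"
    by (rule continuous_on_compose2[OF C1_halflineD(2)[OF f]]) (auto intro!: continuous_intros)
  then show "(\<lambda>s. f' (max 0 s)) \<in> borel_measurable borel"
    by (rule borel_measurable_continuous_onI)
  have "bounded (f' ` {0..t})"
    by (intro compact_imp_bounded compact_continuous_image
        continuous_on_halfline_Icc[OF C1_halflineD(2)[OF f]]) auto
  then obtain C where "C > 0" "\<And>x. x \<in> {0..t} \<Longrightarrow> \<bar>f' x\<bar> \<le> C"
    unfolding bounded_pos by auto
  then show "\<exists>C\<ge>0. \<forall>s\<in>{0..t}. \<bar>f' s\<bar> \<le> C" by (intro exI[of _ C]) auto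
qed

text \<open>Tested against \<xi>, the Wiener integral of the process becomes the same expression for
  the ordinary function \<open>\<integral>\<omega>. \<xi> \<omega> * X s \<omega>
  \<partial>M\<close> of \<open>s\<close>. Since \<xi> is arbitrary, the formula can be applied
  twice, once for each factor of a covariance.\<close>

lemma sq_integrable_wiener_int: "sq_integrable M (\<lambda>\<omega>. wiener_int f f' (\<lambda>s. X s \<omega>) t)" (is ?sq)
  and expectation_mult_wiener_int: "\<And>\<xi>. sq_integrable M \<xi> \<Longrightarrow>
    (\<integral>\<omega>. \<xi> \<omega> * wiener_int f f' (\<lambda>s. X s \<omega>) t \<partial>M)
      = f t * (\<integral>\<omega>. \<xi> \<omega> * X t \<omega> \<partial>M) - integral {0..t} (\<lambda>s. f' s * (\<integral>\<omega>. \<xi> \<omega> * X s \<omega> \<partial>M))"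
proof -
  interpret prob_space M by (rule M)
  have Xm[measurable]: "(\<lambda>(s, \<omega>). X s \<omega>) \<in> borel_measurable (lborel \<Otimes>\<^sub>M M)"
    and cont: "\<And>\<omega>. \<omega> \<in> space M \<Longrightarrow> continuous_on {0..} (\<lambda>s. X s \<omega>)"
    and sq: "\<And>s. 0 \<le> s \<Longrightarrow> sq_integrable M (X s)"
    using X by (auto simp: L2_process_def)
  obtain K where K: "\<And>s. s \<in> {0..t} \<Longrightarrow> (\<integral>\<omega>. (X s \<omega>)\<^sup>2 \<partial>M) \<le> K"
    using X unfolding L2_process_def by blast
  note [measurable] = f'_ext(1)
  obtain C where C: "C \<ge> 0" "\<And>s. s \<in> {0..t} \<Longrightarrow> \<bar>f' s\<bar> \<le> C" using f'_ext(2) by blast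
  define U where "U = (\<lambda>\<omega>. integral {0..t} (\<lambda>s. f' s * X s \<omega>))"
  have fX: "continuous_on {0..} (\<lambda>s. f' s * X s \<omega>)" if "\<omega> \<in> space M" for \<omega>
    by (intro continuous_intros C1_halflineD(2)[OF f] cont that)
  have main: "integrable M (\<lambda>\<omega>. \<xi> \<omega> * U \<omega>)"
    "(\<integral>\<omega>. \<xi> \<omega> * U \<omega> \<partial>M) = integral {0..t} (\<lambda>s. f' s * (\<integral>\<omega>. \<xi> \<omega> * X s \<omega> \<partial>M))"
    if \<xi>: "sq_integrable M \<xi>" for \<xi>
  proof -
    note [measurable] = sq_integrable_measurable[OF \<xi>]
    define Z where "Z = (\<lambda>s \<omega>. f' (max 0 s) * (\<xi> \<omega> * X s \<omega>))"
    define L where "L = C * ((\<integral>\<omega>. (\<xi> \<omega>)\<^sup>2 \<partial>M) + K)"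
    have Z1: "(\<lambda>(s, \<omega>). Z s \<omega>) \<in> borel_measurable (lborel \<Otimes>\<^sub>M M)"
      unfolding Z_def by measurable
    have Z2: "continuous_on {0..} (\<lambda>s. Z s \<omega>)" if "\<omega> \<in> space M" for \<omega>
    proof -
      have "continuous_on {0..} (\<lambda>s. \<xi> \<omega> * (f' s * X s \<omega>))"
        by (intro continuous_intros fX that)
      then show ?thesis
        by (rule continuous_on_cong[THEN iffD1, rotated 2]) (auto simp: Z_def)
    qed
    have Z3: "integrable M (Z s)" if "s \<in> {0..t}" for s
      unfolding Z_def using sq_integrable_mult[OF \<xi> sq[of s]] that by auto
    have Z4: "(\<integral>\<omega>. \<bar>Z s \<omega>\<bar> \<partial>M) \<le> L" if s: "s \<in> {0..t}" for s
    proof -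
      have le: "\<bar>Z s \<omega>\<bar> \<le> C * ((\<xi> \<omega>)\<^sup>2 + (X s \<omega>)\<^sup>2)" for \<omega>
      proof -
        show ?thesis
          unfolding Z_def abs_mult[of "f' _"] using C(1) C(2)[OF s] s
          by (intro mult_mono abs_mult_le_sum_squares) auto
      qed
      have i2: "integrable M (\<lambda>\<omega>. (X s \<omega>)\<^sup>2)" "integrable M (\<lambda>\<omega>. (\<xi> \<omega>)\<^sup>2)"
        using sq[of s] s \<xi> by (auto simp: sq_integrable_def)
      have "(\<integral>\<omega>. \<bar>Z s \<omega>\<bar> \<partial>M) \<le> (\<integral>\<omega>. C * ((\<xi> \<omega>)\<^sup>2 + (X s \<omega>)\<^sup>2) \<partial>M)"
        using Z3[OF s] i2 le by (intro integral_mono) auto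
      also have "\<dots> = C * ((\<integral>\<omega>. (\<xi> \<omega>)\<^sup>2 \<partial>M) + (\<integral>\<omega>. (X s \<omega>)\<^sup>2 \<partial>M))"
        using i2 by simp
      also have "\<dots> \<le> L" unfolding L_def using K[OF s] C(1) by (intro mult_left_mono) auto
      finally show ?thesis .
    qed
    have eq: "integral {0..t} (\<lambda>s. Z s \<omega>) = \<xi> \<omega> * U \<omega>" for \<omega>
    proof -
      have "integral {0..t} (\<lambda>s. Z s \<omega>) = integral {0..t} (\<lambda>s. \<xi> \<omega> * (f' s * X s \<omega>))"
        by (rule Henstock_Kurzweil_Integration.integral_cong) (auto simp: Z_def)
      then show ?thesis by (simp add: U_def)
    qed
    show "integrable M (\<lambda>\<omega>. \<xi> \<omega> * U \<omega>)"
      using Fubini_integral_Icc(1)[where t=t, OF M Z1 Z2 Z3 Z4] by (simp add: eq)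
    have "(\<integral>\<omega>. \<xi> \<omega> * U \<omega> \<partial>M) = integral {0..t} (\<lambda>s. \<integral>\<omega>. Z s \<omega> \<partial>M)"
      using Fubini_integral_Icc(2)[where t=t, OF M Z1 Z2 Z3 Z4] by (simp add: eq)
    also have "\<dots> = integral {0..t} (\<lambda>s. f' s * (\<integral>\<omega>. \<xi> \<omega> * X s \<omega> \<partial>M))"
      by (rule Henstock_Kurzweil_Integration.integral_cong) (auto simp: Z_def)
    finally show "(\<integral>\<omega>. \<xi> \<omega> * U \<omega> \<partial>M) = integral {0..t} (\<lambda>s. f' s * (\<integral>\<omega>. \<xi> \<omega> * X s \<omega> \<partial>M))" .
  qed
  \<comment> \<open>Testing with the constant 1 yields measurability of \<open>U\<close>, which is
    not evident for a function defined path by path.\<close>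
  have "sq_integrable M (\<lambda>\<omega>. 1)" by (simp add: sq_integrable_def)
  from main(1)[OF this] have Um[measurable]: "U \<in> borel_measurable M" by auto
  \<comment> \<open>By \<open>integral_square_le\<close> the square of \<open>U\<close> is at most
    \<open>t\<close> times this time integral of squares, and the latter is again accessible to
    Fubini.\<close>
  have "integrable M (\<lambda>\<omega>. integral {0..t} (\<lambda>s. (f' (max 0 s))\<^sup>2 * (X s \<omega>)\<^sup>2))"
  proof (rule Fubini_integral_Icc(1)[OF M])
    show "(\<lambda>(s, \<omega>). (f' (max 0 s))\<^sup>2 * (X s \<omega>)\<^sup>2) \<in> borel_measurable (lborel \<Otimes>\<^sub>M M)"
      by measurable
    show "continuous_on {0..} (\<lambda>s. (f' (max 0 s))\<^sup>2 * (X s \<omega>)\<^sup>2)" if "\<omega> \<in> space M" for \<omega>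
    proof -
      have "continuous_on {0..} (\<lambda>s. (f' s * X s \<omega>)\<^sup>2)"
        by (intro continuous_intros fX that)
      then show ?thesis
        by (rule continuous_on_cong[THEN iffD1, rotated 2]) (auto simp: power_mult_distrib)
    qed
    show "integrable M (\<lambda>\<omega>. (f' (max 0 s))\<^sup>2 * (X s \<omega>)\<^sup>2)" if "s \<in> {0..t}" for s
      using sq[of s] that by (auto simp: sq_integrable_def)
    show "(\<integral>\<omega>. \<bar>(f' (max 0 s))\<^sup>2 * (X s \<omega>)\<^sup>2\<bar> \<partial>M) \<le> C\<^sup>2 * K" if s: "s \<in> {0..t}" for s
    proof -
      have "(f' s)\<^sup>2 \<le> C\<^sup>2" using C(1) C(2)[OF s] by (metis abs_le_square_iff abs_of_nonneg)
      then show ?thesis using s K[OF s] by (auto simp: abs_mult intro!: mult_mono)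
    qed
  qed
  moreover have "integral {0..t} (\<lambda>s. (f' (max 0 s))\<^sup>2 * (X s \<omega>)\<^sup>2) = integral {0..t} (\<lambda>s. (f' s * X s \<omega>)\<^sup>2)" for \<omega>
    by (rule Henstock_Kurzweil_Integration.integral_cong) (auto simp: power_mult_distrib)
  ultimately have 2: "integrable M (\<lambda>\<omega>. t * integral {0..t} (\<lambda>s. (f' s * X s \<omega>)\<^sup>2))"
    by simp
  have "integrable M (\<lambda>\<omega>. (U \<omega>)\<^sup>2)"
  proof (rule Bochner_Integration.integrable_bound[OF 2])
    show "AE \<omega> in M. norm ((U \<omega>)\<^sup>2) \<le> norm (t * integral {0..t} (\<lambda>s. (f' s * X s \<omega>)\<^sup>2))"
      proof (rule AE_I2)
      fix \<omega> assume "\<omega> \<in> space M"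
      from integral_square_le[OF fX[OF this] t]
      have "(U \<omega>)\<^sup>2 \<le> t * integral {0..t} (\<lambda>s. (f' s * X s \<omega>)\<^sup>2)" by (simp add: U_def)
      then show "norm ((U \<omega>)\<^sup>2) \<le> norm (t * integral {0..t} (\<lambda>s. (f' s * X s \<omega>)\<^sup>2))"
        by simp
    qed
  qed measurable
  then have U: "sq_integrable M U" by (simp add: sq_integrable_def)
  have wiener_int: "wiener_int f f' (\<lambda>s. X s \<omega>) t = f t * X t \<omega> + (-1) * U \<omega>" for \<omega>
    by (simp add: wiener_int_def U_def)
  show ?sq unfolding wiener_int by (intro sq_integrable_add sq_integrable_cmult sq[OF t] U)
  fix \<xi> assume \<xi>: "sq_integrable M \<xi>"
  have "(\<integral>\<omega>. \<xi> \<omega> * wiener_int f f' (\<lambda>s. X s \<omega>) t \<partial>M) = (\<integral>\<omega>. f t * (\<xi> \<omega> * X t \<omega>) - \<xi> \<omega> * U \<omega> \<partial>M)"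
    by (simp add: wiener_int algebra_simps)
  also have "\<dots> = f t * (\<integral>\<omega>. \<xi> \<omega> * X t \<omega> \<partial>M) - (\<integral>\<omega>. \<xi> \<omega> * U \<omega> \<partial>M)"
    using sq_integrable_mult[OF \<xi> sq[OF t]] main(1)[OF \<xi>] by simp
  finally show "(\<integral>\<omega>. \<xi> \<omega> * wiener_int f f' (\<lambda>s. X s \<omega>) t \<partial>M)
      = f t * (\<integral>\<omega>. \<xi> \<omega> * X t \<omega> \<partial>M) - integral {0..t} (\<lambda>s. f' s * (\<integral>\<omega>. \<xi> \<omega> * X s \<omega> \<partial>M))"
    by (simp add: main(2)[OF \<xi>])
qed

end

text \<open>In \<open>u\<close>, the covariance \<open>min s u\<close> is the primitive of the
  indicator of the interval from 0 to \<open>s\<close>, so integrating \<open>g\<close> against it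
  stops at \<open>s\<close>. The kink at \<open>s\<close> is why the integral is split
  there.\<close>

lemma wiener_int_min:
  assumes g: "C1_halfline g g'" and s: "0 \<le> s" "s \<le> t"
  shows "g t * (c * s) - integral {0..t} (\<lambda>u. g' u * (c * min s u)) = c * integral {0..s} g"
proof -
  have id: "C1_halfline (\<lambda>u. u) (\<lambda>_. 1)" by (auto simp: C1_halfline_def)
  have "continuous_on {0..} (\<lambda>u. g' u * (c * min s u))"
    by (intro continuous_intros C1_halflineD(2)[OF g])
  then have "integral {0..t} (\<lambda>u. g' u * (c * min s u)) =
     integral {0..s} (\<lambda>u. g' u * (c * min s u)) + integral {s..t} (\<lambda>u. g' u * (c * min s u))"
    using s by (intro Henstock_Kurzweil_Integration.integral_combine[symmetric] integrable_on_halfline_Icc) auto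
  also have "integral {0..s} (\<lambda>u. g' u * (c * min s u)) = integral {0..s} (\<lambda>u. c * (g' u * u))"
    by (rule Henstock_Kurzweil_Integration.integral_cong) auto
  also have "\<dots> = c * (g s * s - integral {0..s} g)"
    using C1_halfline_by_parts[OF g id s(1)] by simp
  also have "integral {s..t} (\<lambda>u. g' u * (c * min s u)) = integral {s..t} (\<lambda>u. (c * s) * g' u)"
    by (rule Henstock_Kurzweil_Integration.integral_cong) auto
  also have "\<dots> = (c * s) * (g t - g s)"
    using integral_unique[OF C1_halfline_FTC[OF g, of s]] integral_unique[OF C1_halfline_FTC[OF g, of t]]
      Henstock_Kurzweil_Integration.integral_combine[OF s integrable_on_halfline_Icc[OF C1_halflineD(2)[OF g]]] s
    by simp
  finally show ?thesis by (simp add: algebra_simps)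
qed

text \<open>The Ito isometry in polarized form. One factor is integrated at a time: first
  \<open>Y\<close> against \<open>X s\<close>, giving \<open>c\<close> times the primitive of
  \<open>g\<close>, then \<open>X\<close> against that primitive by parts. One Brownian motion with
  itself has \<open>c = 1\<close>, two independent ones have \<open>c = 0\<close>.\<close>

lemma wiener_int_covariance:
  assumes M: "prob_space M" and X: "L2_process M X" and Y: "L2_process M Y"
    and f: "C1_halfline f f'" and g: "C1_halfline g g'" and t: "0 \<le> t"
    and cov: "\<And>s u. 0 \<le> s \<Longrightarrow> 0 \<le> u \<Longrightarrow> (\<integral>\<omega>. X s \<omega> * Y u \<omega> \<partial>M) = c * min s u"
  shows "(\<integral>\<omega>. wiener_int f f' (\<lambda>s. X s \<omega>) t * wiener_int g g' (\<lambda>s. Y s \<omega>) t \<partial>M) = c * integral {0..t} (\<lambda>s. f s * g s)"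
proof -
  have gI: "C1_halfline (\<lambda>s. integral {0..s} g) g"
    by (rule C1_halfline_integral[OF C1_halfline_continuous[OF g]])
  have m: "(\<integral>\<omega>. X s \<omega> * wiener_int g g' (\<lambda>s. Y s \<omega>) t \<partial>M) = c * integral {0..s} g" if s: "s \<in> {0..t}" for s
  proof -
    have "sq_integrable M (X s)" using X s by (auto simp: L2_process_def)
    from expectation_mult_wiener_int[OF M Y g t this]
    have "(\<integral>\<omega>. X s \<omega> * wiener_int g g' (\<lambda>s. Y s \<omega>) t \<partial>M)
       = g t * (c * min s t) - integral {0..t} (\<lambda>u. g' u * (\<integral>\<omega>. X s \<omega> * Y u \<omega> \<partial>M))"
      using s t by (simp add: cov)
    also have "integral {0..t} (\<lambda>u. g' u * (\<integral>\<omega>. X s \<omega> * Y u \<omega> \<partial>M)) = integral {0..t} (\<lambda>u. g' u * (c * min s u))"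
      by (rule Henstock_Kurzweil_Integration.integral_cong) (use s in \<open>auto simp: cov\<close>)
    finally show ?thesis using wiener_int_min[OF g, of s t c] s by simp
  qed
  have "(\<integral>\<omega>. wiener_int f f' (\<lambda>s. X s \<omega>) t * wiener_int g g' (\<lambda>s. Y s \<omega>) t \<partial>M)
     = (\<integral>\<omega>. wiener_int g g' (\<lambda>s. Y s \<omega>) t * wiener_int f f' (\<lambda>s. X s \<omega>) t \<partial>M)"
    by (simp add: mult.commute)
  also have "\<dots> = f t * (\<integral>\<omega>. wiener_int g g' (\<lambda>s. Y s \<omega>) t * X t \<omega> \<partial>M)
      - integral {0..t} (\<lambda>s. f' s * (\<integral>\<omega>. wiener_int g g' (\<lambda>s. Y s \<omega>) t * X s \<omega> \<partial>M))"
    by (rule expectation_mult_wiener_int[OF M X f t sq_integrable_wiener_int[OF M Y g t]])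
  also have "(\<integral>\<omega>. wiener_int g g' (\<lambda>s. Y s \<omega>) t * X t \<omega> \<partial>M) = c * integral {0..t} g"
    using m[of t] t by (simp add: mult.commute)
  also have "integral {0..t} (\<lambda>s. f' s * (\<integral>\<omega>. wiener_int g g' (\<lambda>s. Y s \<omega>) t * X s \<omega> \<partial>M))
     = integral {0..t} (\<lambda>s. c * (f' s * integral {0..s} g))"
    by (rule Henstock_Kurzweil_Integration.integral_cong) (use m in \<open>auto simp: mult.commute mult.left_commute\<close>)
  also have "\<dots> = c * (f t * integral {0..t} g - integral {0..t} (\<lambda>s. f s * g s))"
    using C1_halfline_by_parts[OF f gI t] by simp
  finally show ?thesis by (simp add: algebra_simps)
qed

section \<open>Brownian motion\<close>

text \<open>Paths are set to zero on a null set and approximated by step functions in time, which gives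
  joint measurability.\<close>

lemma continuous_modification:
  fixes X :: "real \<Rightarrow> 'a \<Rightarrow> real"
  assumes X: "\<And>t. 0 \<le> t \<Longrightarrow> X t \<in> borel_measurable M"
    and cont: "AE \<omega> in M. continuous_on {0..} (\<lambda>t. X t \<omega>)"
  obtains X' where "(\<lambda>(s, \<omega>). X' s \<omega>) \<in> borel_measurable (lborel \<Otimes>\<^sub>M M)"
    and "\<And>\<omega>. continuous_on {0..} (\<lambda>s. X' s \<omega>)"
    and "\<And>s. X' s \<in> borel_measurable M"
    and "AE \<omega> in M. \<forall>t\<ge>0. X' t \<omega> = X t \<omega>"
proof -
  from cont obtain N where N: "{\<omega> \<in> space M. \<not> continuous_on {0..} (\<lambda>t. X t \<omega>)} \<subseteq> N"
    "emeasure M N = 0" "N \<in> sets M" by (rule AE_E)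
  \<comment> \<open>Freezing the path at its initial value for negative times makes it continuous on
    the whole line; joint measurability over \<open>lborel\<close> concerns all real times.\<close>
  define X' where "X' = (\<lambda>s \<omega>. if \<omega> \<in> space M - N then X (max 0 s) \<omega> else 0)"
  have N'[measurable]: "space M - N \<in> sets M" using N by auto
  have meas[measurable]: "X' s \<in> borel_measurable M" for s
    unfolding X'_def using X[of "max 0 s"] by measurable
  have contU: "continuous_on UNIV (\<lambda>s. X' s \<omega>)" for \<omega>
  proof (cases "\<omega> \<in> space M - N")
    case True
    then have "continuous_on {0..} (\<lambda>t. X t \<omega>)" using N by auto
    then have "continuous_on UNIV (\<lambda>s. X (max 0 s) \<omega>)"
      by (rule continuous_on_compose2) (auto intro!: continuous_intros)
    then show ?thesis using True by (simp add: X'_def)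
  qed (auto simp: X'_def)
  have joint: "(\<lambda>(s, \<omega>). X' s \<omega>) \<in> borel_measurable (lborel \<Otimes>\<^sub>M M)"
  proof (rule borel_measurable_LIMSEQ_real)
    fix p :: "real \<times> 'a"
    obtain s \<omega> where p: "p = (s, \<omega>)" by (cases p)
    have "(\<lambda>m. of_int \<lfloor>real (Suc m) * s\<rfloor> / real (Suc m)) \<longlonglongrightarrow> s"
    proof (rule LIMSEQ_I)
      fix r :: real assume r: "r > 0"
      obtain n0 where n0: "real n0 > 1 / r" using reals_Archimedean2 by blast
      have "norm (of_int \<lfloor>real (Suc m) * s\<rfloor> / real (Suc m) - s) < r" if "m \<ge> n0" for m
      proof -
        have "norm (of_int \<lfloor>real (Suc m) * s\<rfloor> / real (Suc m) - s)
          = \<bar>of_int \<lfloor>real (Suc m) * s\<rfloor> - real (Suc m) * s\<bar> / real (Suc m)"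
          by (simp add: field_simps del: of_nat_Suc flip: abs_divide)
        also have "\<dots> \<le> 1 / real (Suc m)"
          by (intro divide_right_mono) (linarith | simp)+
        also have "\<dots> < r"
        proof -
          have "1 / r < real (Suc m)" using n0 that by simp
          then show ?thesis using r by (simp add: field_simps)
        qed
        finally show ?thesis .
      qed
      then show "\<exists>no. \<forall>m\<ge>no. norm (of_int \<lfloor>real (Suc m) * s\<rfloor> / real (Suc m) - s) < r" by blast
    qed
    moreover have "isCont (\<lambda>s. X' s \<omega>) s"
      using contU[of \<omega>] by (simp add: continuous_on_eq_continuous_at)
    ultimately have "(\<lambda>m. X' (of_int \<lfloor>real (Suc m) * s\<rfloor> / real (Suc m)) \<omega>) \<longlonglongrightarrow> X' s \<omega>"
      by (rule isCont_tendsto_compose[rotated])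
    then show "(\<lambda>m. (\<lambda>(s, \<omega>). X' (of_int \<lfloor>real (Suc m) * s\<rfloor> / real (Suc m)) \<omega>) p) \<longlonglongrightarrow> (case p of (s, \<omega>) \<Rightarrow> X' s \<omega>)"
      by (simp add: p)
  next
    fix m
    have "(\<lambda>p. X' (of_int \<lfloor>real (Suc m) * fst p\<rfloor> / real (Suc m)) (snd p)) \<in> borel_measurable (lborel \<Otimes>\<^sub>M M)"
      by (rule measurable_compose_countable[where f="\<lambda>i p. X' (of_int i / real (Suc m)) (snd p)"
            and g="\<lambda>p. \<lfloor>real (Suc m) * fst p\<rfloor>"]) measurable
    then show "(\<lambda>(s, \<omega>). X' (of_int \<lfloor>real (Suc m) * s\<rfloor> / real (Suc m)) \<omega>) \<in> borel_measurable (lborel \<Otimes>\<^sub>M M)"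
      by (simp add: case_prod_beta')
  qed
  have "AE \<omega> in M. \<omega> \<notin> N" using N by (intro AE_not_in) (auto simp: null_sets_def)
  then have ae: "AE \<omega> in M. \<forall>t\<ge>0. X' t \<omega> = X t \<omega>"
    using AE_space by eventually_elim (auto simp: X'_def)
  show thesis
    by (rule that[OF joint _ meas ae]) (rule continuous_on_subset[OF contU], simp)
qed

section \<open>Moments, covariance and a regular modification of Brownian motion\<close>

lemma (in prob_space) normal_moments:
  assumes "0 < \<sigma>" "distributed M lborel X (normal_density 0 \<sigma>)"
  shows "sq_integrable M X" "expectation X = 0" "expectation (\<lambda>\<omega>. (X \<omega>)\<^sup>2) = \<sigma>\<^sup>2"
proof -
  show "expectation X = 0" by (rule normal_distributed_expectation[OF assms])
  then show "expectation (\<lambda>\<omega>. (X \<omega>)\<^sup>2) = \<sigma>\<^sup>2"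
    using normal_distributed_variance[OF assms] by simp
  have "integrable M (\<lambda>\<omega>. (X \<omega>)\<^sup>2)"
    using integrable_normal_moment[OF assms(1), of 0 2]
      distributed_integrable[OF assms(2), of "\<lambda>x. x\<^sup>2"] by simp
  moreover have "X \<in> borel_measurable M"
    using distributed_measurable[OF assms(2)] by simp
  ultimately show "sq_integrable M X" by (simp add: sq_integrable_def)
qed

lemma sq_integrable_cong_AE:
  assumes "sq_integrable M X" "Y \<in> borel_measurable M" "AE \<omega> in M. X \<omega> = Y \<omega>"
  shows "sq_integrable M Y"
proof -
  note [measurable] = assms(2) sq_integrable_measurable[OF assms(1)]
  have "integrable M (\<lambda>\<omega>. (X \<omega>)\<^sup>2) \<longleftrightarrow> integrable M (\<lambda>\<omega>. (Y \<omega>)\<^sup>2)"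
    by (rule Bochner_Integration.integrable_cong_AE) (use assms(3) in auto)
  then show ?thesis using assms by (simp add: sq_integrable_def)
qed

lemma (in prob_space) sq_integrable_integrable:
  assumes "sq_integrable M X"
  shows "integrable M X"
  using sq_integrable_mult[OF assms, of "\<lambda>_. 1"] by (simp add: sq_integrable_def)

context
  fixes M :: "'a measure" and B :: "real \<Rightarrow> 'a \<Rightarrow> real"
  assumes B: "brownian_motion M B"
begin

interpretation prob_space M using B by (simp add: brownian_motion_def)

private lemma B_measurable: "0 \<le> t \<Longrightarrow> B t \<in> borel_measurable M"
  using B by (simp add: brownian_motion_def)

private lemma B_0: "AE \<omega> in M. B 0 \<omega> = 0"
  using B by (simp add: brownian_motion_def)

lemma brownian_moments:
  assumes t: "0 \<le> t"
  shows "sq_integrable M (B t)" "expectation (B t) = 0" "expectation (\<lambda>\<omega>. (B t \<omega>)\<^sup>2) = t"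
proof -
  note [measurable] = B_measurable[OF order_refl] B_measurable[OF t]
  have "sq_integrable M (B t) \<and> expectation (B t) = 0 \<and> expectation (\<lambda>\<omega>. (B t \<omega>)\<^sup>2) = t"
  \<comment> \<open>The Gaussian law is available for increments over intervals of positive length
    only, and \<open>B 0\<close> vanishes merely almost surely, so time 0 is treated apart.\<close>
  proof (cases "t = 0")
    case True
    have ae: "AE \<omega> in M. B t \<omega> = 0" using B_0 True by simp
    have "sq_integrable M (B t)"
      by (rule sq_integrable_cong_AE[of M "\<lambda>_. 0"]) (use ae in \<open>auto simp: sq_integrable_def\<close>)
    moreover have "expectation (B t) = expectation (\<lambda>_. 0)"
      by (rule integral_cong_AE) (use ae in auto)
    moreover have "expectation (\<lambda>\<omega>. (B t \<omega>)\<^sup>2) = expectation (\<lambda>_. 0)"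
      by (rule integral_cong_AE) (use ae in auto)
    ultimately show ?thesis using True by simp
  next
    case False
    have "\<forall>s t. 0 \<le> s \<and> s < t \<longrightarrow>
        distributed M lborel (\<lambda>\<omega>. B t \<omega> - B s \<omega>) (normal_density 0 (sqrt (t - s)))"
      using B unfolding brownian_motion_def by blast
    from this[rule_format, of 0 t] have D: "distributed M lborel (\<lambda>\<omega>. B t \<omega> - B 0 \<omega>) (normal_density 0 (sqrt t))"
      using False t by simp
    note m = normal_moments[OF _ D]
    have ae: "AE \<omega> in M. B t \<omega> - B 0 \<omega> = B t \<omega>" using B_0 by auto
    have "sq_integrable M (B t)"
      by (rule sq_integrable_cong_AE[OF m(1)]) (use ae False t in auto)
    moreover have "expectation (B t) = expectation (\<lambda>\<omega>. B t \<omega> - B 0 \<omega>)"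
      by (rule integral_cong_AE) (use ae in auto)
    moreover have "expectation (\<lambda>\<omega>. (B t \<omega>)\<^sup>2) = expectation (\<lambda>\<omega>. (B t \<omega> - B 0 \<omega>)\<^sup>2)"
      by (rule integral_cong_AE) (use ae in auto)
    ultimately show ?thesis using m False t by simp
  qed
  then show "sq_integrable M (B t)" "expectation (B t) = 0" "expectation (\<lambda>\<omega>. (B t \<omega>)\<^sup>2) = t"
    by auto
qed

text \<open>For \<open>s \<le> t\<close> the increment after \<open>s\<close> is independent of
  \<open>B s\<close> and centred, so only the variance of \<open>B s\<close> is left.\<close>

lemma brownian_covariance:
  assumes s: "0 \<le> s" and t: "0 \<le> t"
  shows "expectation (\<lambda>\<omega>. B s \<omega> * B t \<omega>) = min s t"
proof -
  have *: "expectation (\<lambda>\<omega>. B s \<omega> * B t \<omega>) = s" if st: "0 \<le> s" "s \<le> t" for s t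
  proof -
    have t: "0 \<le> t" using st by simp
    note [measurable] = B_measurable[OF order_refl] B_measurable[OF st(1)] B_measurable[OF t]
    \<comment> \<open>The partition points 0, \<open>s\<close>, \<open>t\<close>: its first two
      increments are the independent pair.\<close>
    define p where "p = (\<lambda>j::nat. if j = 0 then 0 else if j = 1 then s else t)"
    have iv: "indep_vars (\<lambda>_. borel) (\<lambda>j \<omega>. B (p (Suc j)) \<omega> - B (p j) \<omega>) {..<2::nat}"
    proof -
      have "0 \<le> p 0 \<and> (\<forall>j<2. p j \<le> p (Suc j))" using st by (auto simp: p_def)
      then show ?thesis using B unfolding brownian_motion_def by blast
    qed
    have i: "integrable M (B s)" "integrable M (B t)" "integrable M (B 0)"
      using brownian_moments(1) sq_integrable_integrable st t by auto
    have "expectation (\<lambda>\<omega>. \<Prod>j<2. B (p (Suc j)) \<omega> - B (p j) \<omega>)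
       = (\<Prod>j<2. expectation (\<lambda>\<omega>. B (p (Suc j)) \<omega> - B (p j) \<omega>))"
      by (rule indep_vars_lebesgue_integral[OF _ iv]) (use i in \<open>auto simp: p_def\<close>)
    then have "expectation (\<lambda>\<omega>. (B s \<omega> - B 0 \<omega>) * (B t \<omega> - B s \<omega>))
       = expectation (\<lambda>\<omega>. B s \<omega> - B 0 \<omega>) * expectation (\<lambda>\<omega>. B t \<omega> - B s \<omega>)"
      by (simp add: p_def numeral_2_eq_2)
    also have "\<dots> = 0" using i brownian_moments(2) st t by simp
    also have "expectation (\<lambda>\<omega>. (B s \<omega> - B 0 \<omega>) * (B t \<omega> - B s \<omega>))
       = expectation (\<lambda>\<omega>. B s \<omega> * B t \<omega> - (B s \<omega>)\<^sup>2)"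
      by (rule integral_cong_AE) (use B_0 in \<open>auto simp: power2_eq_square algebra_simps\<close>)
    also have "\<dots> = expectation (\<lambda>\<omega>. B s \<omega> * B t \<omega>) - expectation (\<lambda>\<omega>. (B s \<omega>)\<^sup>2)"
      using sq_integrable_mult[OF brownian_moments(1)[OF st(1)] brownian_moments(1)[OF t]]
        brownian_moments(1)[OF st(1)]
      by (intro Bochner_Integration.integral_diff) (auto simp: sq_integrable_def)
    finally show ?thesis using brownian_moments(3)[OF st(1)] by simp
  qed
  show ?thesis
    using *[of s t] *[of t s] s t by (cases "s \<le> t") (auto simp: mult.commute min_def)
qed

lemma brownian_L2_modification:
  obtains X where "L2_process M X" "AE \<omega> in M. \<forall>t\<ge>0. X t \<omega> = B t \<omega>"
proof -
  have "AE \<omega> in M. continuous_on {0..} (\<lambda>t. B t \<omega>)"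
    using B by (simp add: brownian_motion_def)
  from continuous_modification[OF B_measurable this] obtain X where X:
    "(\<lambda>(s, \<omega>). X s \<omega>) \<in> borel_measurable (lborel \<Otimes>\<^sub>M M)"
    "\<And>\<omega>. continuous_on {0..} (\<lambda>s. X s \<omega>)" "\<And>s. X s \<in> borel_measurable M"
    "AE \<omega> in M. \<forall>t\<ge>0. X t \<omega> = B t \<omega>" by blast
  note [measurable] = X(3)
  have ae: "AE \<omega> in M. B s \<omega> = X s \<omega>" if "0 \<le> s" for s
    using X(4) that by auto
  have sq: "sq_integrable M (X s)" if "0 \<le> s" for s
    by (rule sq_integrable_cong_AE[OF brownian_moments(1)[OF that] X(3) ae[OF that]])
  have m2: "expectation (\<lambda>\<omega>. (X s \<omega>)\<^sup>2) = s" if s: "0 \<le> s" for s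
  proof -
    note [measurable] = B_measurable[OF s]
    have "expectation (\<lambda>\<omega>. (X s \<omega>)\<^sup>2) = expectation (\<lambda>\<omega>. (B s \<omega>)\<^sup>2)"
      by (rule integral_cong_AE) (use ae[OF s] in auto)
    then show ?thesis using brownian_moments(3)[OF s] by simp
  qed
  have "\<exists>K. \<forall>s\<in>{0..t}. expectation (\<lambda>\<omega>. (X s \<omega>)\<^sup>2) \<le> K" for t
    by (rule exI[of _ t]) (auto simp: m2)
  then have "L2_process M X"
    unfolding L2_process_def using X(1,2) sq by blast
  from that[OF this X(4)] show thesis .
qed

end

section \<open>From independence to vanishing covariances\<close>

lemma process_algebra_vimage:
  assumes "0 \<le> t"
  shows "sigma_sets (space M) {X t -` A \<inter> space M | A. A \<in> sets borel} \<subseteq> process_algebra M X"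
  unfolding process_algebra_def by (rule sigma_sets_mono') (use assms in auto)

text \<open>Independence passes from the \<sigma>-algebras of whole processes to those of single
  times. The expectation of the product then factors, and one centred factor makes it zero.\<close>

lemma (in prob_space) uncorrelated_of_indep_process_algebra:
  fixes F :: "nat \<Rightarrow> 'a set set"
  assumes ind: "indep_sets F I" and ij: "i \<in> I" "j \<in> I" "i \<noteq> j"
    and F: "F i = process_algebra M X" "F j = process_algebra M Y"
    and st: "0 \<le> s" "0 \<le> t"
    and X: "integrable M (X s)" and Y: "integrable M (Y t)" and Y0: "expectation (Y t) = 0"
  shows "expectation (\<lambda>\<omega>. X s \<omega> * Y t \<omega>) = 0"
proof -
  let ?A = "sigma_sets (space M) {X s -` A \<inter> space M | A. A \<in> sets borel}"
  let ?B = "sigma_sets (space M) {Y t -` A \<inter> space M | A. A \<in> sets borel}"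
  have sub: "?A \<subseteq> F i" "?B \<subseteq> F j"
    unfolding F by (intro process_algebra_vimage st)+
  have ev: "F i \<subseteq> events" "F j \<subseteq> events"
    using ind ij by (auto simp: indep_sets_def)
  have "indep_set ?A ?B"
  proof (rule indep_setI)
    show "?A \<subseteq> events" "?B \<subseteq> events" using sub ev by auto
    fix a b assume ab: "a \<in> ?A" "b \<in> ?B"
    have a: "a \<in> F i" and b: "b \<in> F j" using ab sub by blast+
    have "prob (\<Inter>l\<in>{i, j}. (if l = i then a else b)) = (\<Prod>l\<in>{i, j}. prob (if l = i then a else b))"
      by (rule indep_setsD[OF ind]) (use ij a b in \<open>simp_all del: Inter_iff\<close>)
    then show "prob (a \<inter> b) = prob a * prob b" using ij by (auto simp: Int_commute)
  qed
  then have "indep_var borel (X s) borel (Y t)"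
    unfolding indep_var_eq using X Y by (intro conjI) (assumption | rule borel_measurable_integrable)+
  from indep_var_lebesgue_integral[OF this X Y] show ?thesis by (simp add: Y0)
qed

section \<open>Pathwise solution of the filter equations\<close>

locale kalman_filter =
  fixes R C T k Vmeas \<tau> \<sigma> :: real and Tmin :: "real \<Rightarrow> real"
  assumes R: "R > 0" and C: "C > 0" and T: "T > 0" and k: "k > 0" and Vmeas: "Vmeas > 0"
    and \<tau>_def: "\<tau> = R * C" and \<sigma>_def: "\<sigma> = 2 * k * T * R / Vmeas"
    and Tmin: "\<And>t. t \<ge> 0 \<Longrightarrow> (Tmin has_real_derivative
         (2 * (T - Tmin t) - \<sigma> * (Tmin t)\<^sup>2 / (2 * T)) / \<tau>) (at t within {0..})"
    and Tmin_0: "Tmin 0 = T"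
begin

definition Tmin' :: "real \<Rightarrow> real" where
  "Tmin' t = (2 * (T - Tmin t) - \<sigma> * (Tmin t)\<^sup>2 / (2 * T)) / \<tau>"

text \<open>The Kalman gain, multiplying the innovation \<open>sqrt Vmeas dY - vhat dt\<close> in
  the estimate equation.\<close>

definition g :: "real \<Rightarrow> real" where "g t = \<sigma> * Tmin t / (2 * T)"
definition g' :: "real \<Rightarrow> real" where "g' t = \<sigma> / (2 * T) * Tmin' t"
definition a :: "real \<Rightarrow> real" where "a t = (1 + g t) / \<tau>"
text \<open>\<open>E\<close> and \<open>F G\<close> are the integrating factors of \<open>v - vhat\<close> and of \<open>vhat\<close>; the gain drives
  \<open>F G * vhat\<close> by \<open>K' G * (E * (v - vhat))\<close>.\<close>

definition E :: "real \<Rightarrow> real" where "E t = exp (integral {0..t} a)"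
definition E' :: "real \<Rightarrow> real" where "E' t = a t * E t"
definition c :: "real \<Rightarrow> real" where "c G = (1 + R * G) / \<tau>"
definition F :: "real \<Rightarrow> real \<Rightarrow> real" where "F G t = exp (c G * t)"
definition F' :: "real \<Rightarrow> real \<Rightarrow> real" where "F' G t = c G * F G t"
definition K' :: "real \<Rightarrow> real \<Rightarrow> real" where "K' G t = F G t * g t / (\<tau> * E t)"
definition K :: "real \<Rightarrow> real \<Rightarrow> real" where "K G t = integral {0..t} (K' G)"
text \<open>Noise amplitudes after division by \<tau>: the error feels \<open>\<beta> dB\<close> and
  \<open>- \<gamma> * g dBmeas\<close>.\<close>

definition \<beta> :: real where "\<beta> = sqrt (2 * k * T * R) / \<tau>"
definition \<gamma> :: real where "\<gamma> = sqrt Vmeas / \<tau>"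

lemma \<tau>_pos: "\<tau> > 0"
  using R C by (simp add: \<tau>_def)

lemma C1_Tmin: "C1_halfline Tmin Tmin'"
proof -
  have "continuous_on {0..} Tmin"
    using Tmin by (auto simp: continuous_on_eq_continuous_within intro!: DERIV_continuous)
  then have "continuous_on {0..} Tmin'"
    unfolding Tmin'_def using T \<tau>_pos by (intro continuous_intros) auto
  then show ?thesis using Tmin by (simp add: C1_halfline_def Tmin'_def)
qed

lemma C1_g: "C1_halfline g g'"
  by (rule C1_halfline_cong[OF C1_halfline_cmult[OF C1_Tmin, of "\<sigma> / (2 * T)"]])
    (auto simp: g_def g'_def)

lemma a_continuous: "continuous_on {0..} a"
  unfolding a_def using \<tau>_pos by (intro continuous_intros C1_halfline_continuous[OF C1_g]) auto

lemma C1_E: "C1_halfline E E'"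
  unfolding E_def[abs_def] E'_def[abs_def]
  by (rule C1_halfline_exp[OF C1_halfline_integral[OF a_continuous]])

lemma E_pos: "E t > 0" and E_0: "E 0 = 1"
  by (auto simp: E_def)

lemma C1_F: "C1_halfline (F G) (F' G)"
proof -
  have "C1_halfline (\<lambda>t. c G * t) (\<lambda>_. c G)" by (auto simp: C1_halfline_def intro!: derivative_eq_intros)
  from C1_halfline_exp[OF this] show ?thesis by (simp add: F_def[abs_def] F'_def[abs_def])
qed

lemma F_pos: "F G t > 0" and F_0: "F G 0 = 1"
  by (auto simp: F_def)

lemma K'_continuous: "continuous_on {0..} (K' G)"
  unfolding K'_def using \<tau>_pos E_pos
  by (intro continuous_intros C1_halfline_continuous[OF C1_g] C1_halfline_continuous[OF C1_E]
      C1_halfline_continuous[OF C1_F]) (metis less_irrefl mult_pos_pos)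

lemma C1_K: "C1_halfline (K G) (K' G)"
  unfolding K_def[abs_def] by (rule C1_halfline_integral[OF K'_continuous])

lemma K_0: "K G 0 = 0"
  by (simp add: K_def)

lemmas conts = C1_halfline_continuous[OF C1_g] C1_halfline_continuous[OF C1_E]
  C1_halfline_continuous[OF C1_F] C1_halfline_continuous[OF C1_K] C1_halfline_continuous[OF C1_Tmin]
  C1_halflineD(2)[OF C1_g] C1_halflineD(2)[OF C1_E]
  C1_halflineD(2)[OF C1_F] C1_halflineD(2)[OF C1_K]

text \<open>Since \<open>wiener_int\<close> takes kernel and derivative, both are named, in the form
  that the product rule and \<open>wiener_int_mult\<close> deliver.\<close>

definition Eg :: "real \<Rightarrow> real" where "Eg t = E t * g t"
definition Eg' :: "real \<Rightarrow> real" where "Eg' t = E' t * g t + E t * g' t"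
definition Fg :: "real \<Rightarrow> real \<Rightarrow> real" where "Fg G t = F G t * g t"
definition Fg' :: "real \<Rightarrow> real \<Rightarrow> real" where "Fg' G t = F' G t * g t + F G t * g' t"
definition KE :: "real \<Rightarrow> real \<Rightarrow> real" where "KE G t = K G t * E t"
definition KE' :: "real \<Rightarrow> real \<Rightarrow> real" where "KE' G t = K' G t * E t + K G t * E' t"
definition KEg :: "real \<Rightarrow> real \<Rightarrow> real" where "KEg G t = K G t * Eg t"
definition KEg' :: "real \<Rightarrow> real \<Rightarrow> real" where "KEg' G t = K' G t * Eg t + K G t * Eg' t"

lemma C1_Eg: "C1_halfline Eg Eg'"
  unfolding Eg_def[abs_def] Eg'_def[abs_def] by (rule C1_halfline_mult[OF C1_E C1_g])
lemma C1_Fg: "C1_halfline (Fg G) (Fg' G)"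
  unfolding Fg_def[abs_def] Fg'_def[abs_def] by (rule C1_halfline_mult[OF C1_F C1_g])
lemma C1_KE: "C1_halfline (KE G) (KE' G)"
  unfolding KE_def[abs_def] KE'_def[abs_def] by (rule C1_halfline_mult[OF C1_K C1_E])
lemma C1_KEg: "C1_halfline (KEg G) (KEg' G)"
  unfolding KEg_def[abs_def] KEg'_def[abs_def] by (rule C1_halfline_mult[OF C1_K C1_Eg])

definition error_path :: "(real \<Rightarrow> real) \<Rightarrow> (real \<Rightarrow> real) \<Rightarrow> real \<Rightarrow> real \<Rightarrow> real" where
  "error_path b bm x0 t = x0 + \<beta> * wiener_int E E' b t - \<gamma> * wiener_int Eg Eg' bm t"

section \<open>Solving the equations along one fixed sample path\<close>

context
  fixes G :: real and v vhat Y J b bm :: "real \<Rightarrow> real" and x0 :: real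
  assumes cont: "continuous_on {0..} v" "continuous_on {0..} vhat" "continuous_on {0..} Y"
      "continuous_on {0..} b" "continuous_on {0..} bm"
    and init: "v 0 = x0" "vhat 0 = 0" "Y 0 = 0" "b 0 = 0" "bm 0 = 0"
    and dv: "\<And>t. 0 \<le> t \<Longrightarrow> ((\<lambda>s. - v s + R * (- G * vhat s)) has_integral
        (\<tau> * v t - \<tau> * v 0) - (sqrt (2 * k * T * R) * b t - sqrt (2 * k * T * R) * b 0)) {0..t}"
    and dY: "\<And>t. 0 \<le> t \<Longrightarrow> ((\<lambda>s. v s / sqrt Vmeas) has_integral (Y t - Y 0) - (bm t - bm 0)) {0..t}"
    and dvhat: "\<And>t. 0 \<le> t \<Longrightarrow> ((\<lambda>s. (- vhat s + R * (- G * vhat s)) - \<sigma> * Tmin s / (2 * T) * vhat s)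
        has_integral (\<tau> * vhat t - \<tau> * vhat 0) - (J t - J 0)) {0..t}"
    and J: "\<And>t. 0 \<le> t \<Longrightarrow> J t = wiener_int (\<lambda>t. sqrt Vmeas * g t) (\<lambda>t. sqrt Vmeas * g' t) Y t - sqrt Vmeas * g 0 * Y 0"
begin

text \<open>The observation is measurement noise plus a primitive of \<open>v / sqrt Vmeas\<close>.
  By linearity in the path the noise part keeps its Wiener integral, while the smooth part becomes a
  time integral in which \<open>sqrt Vmeas\<close> cancels.\<close>

private lemma J_eq:
  assumes t: "0 \<le> t"
  shows "J t = sqrt Vmeas * wiener_int g g' bm t + integral {0..t} (\<lambda>s. g s * v s)"
proof -
  have sV: "sqrt Vmeas > 0" using Vmeas by simp
  have q: "continuous_on {0..} (\<lambda>s. v s / sqrt Vmeas)"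
    using sV by (intro continuous_intros cont) auto
  have I: "continuous_on {0..} (\<lambda>t. integral {0..t} (\<lambda>s. v s / sqrt Vmeas))"
    by (rule C1_halfline_continuous[OF C1_halfline_integral[OF q]])
  have Y: "Y s = 1 * bm s + 1 * integral {0..s} (\<lambda>s. v s / sqrt Vmeas)" if "0 \<le> s" for s
    using integral_unique[OF dY[OF that]] init by simp
  have "wiener_int (\<lambda>t. sqrt Vmeas * g t) (\<lambda>t. sqrt Vmeas * g' t) Y t = sqrt Vmeas * wiener_int g g' Y t"
    using wiener_int_linear_kernel[OF C1_g C1_g cont(3), of "sqrt Vmeas" 0 t] by simp
  also have "wiener_int g g' Y t = wiener_int g g' (\<lambda>s. 1 * bm s + 1 * integral {0..s} (\<lambda>s. v s / sqrt Vmeas)) t"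
  proof -
    have "integral {0..t} (\<lambda>s. g' s * Y s)
       = integral {0..t} (\<lambda>s. g' s * (1 * bm s + 1 * integral {0..s} (\<lambda>s. v s / sqrt Vmeas)))"
      by (rule Henstock_Kurzweil_Integration.integral_cong) (simp add: Y)
    then show ?thesis using Y[OF t] by (simp add: wiener_int_def)
  qed
  also have "\<dots> = wiener_int g g' bm t + integral {0..t} (\<lambda>s. g s * (v s / sqrt Vmeas))"
    unfolding wiener_int_linear_path[OF C1_g cont(5) I] wiener_int_integral[OF C1_g q t] by simp
  also have "sqrt Vmeas * (wiener_int g g' bm t + integral {0..t} (\<lambda>s. g s * (v s / sqrt Vmeas)))
     = sqrt Vmeas * wiener_int g g' bm t + integral {0..t} (\<lambda>s. sqrt Vmeas * (g s * (v s / sqrt Vmeas)))"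
    by (simp add: distrib_left)
  also have "(\<lambda>s. sqrt Vmeas * (g s * (v s / sqrt Vmeas))) = (\<lambda>s. g s * v s)"
    using sV by (auto simp: field_simps)
  finally show ?thesis using J[OF t] init by simp
qed

private lemma vhat_eq:
  assumes t: "0 \<le> t"
  shows "((\<lambda>s. - vhat s - R * G * vhat s + g s * (v s - vhat s)) has_integral
     \<tau> * vhat t - sqrt Vmeas * wiener_int g g' bm t) {0..t}"
proof -
  have J0: "J 0 = 0" using J[of 0] by simp
  have "((\<lambda>s. g s * v s) has_integral integral {0..t} (\<lambda>s. g s * v s)) {0..t}"
    by (intro integrable_integral integrable_on_halfline_Icc continuous_intros conts cont)
  from has_integral_add[OF dvhat[OF t] this]
  have "((\<lambda>s. (- vhat s + R * (- G * vhat s)) - \<sigma> * Tmin s / (2 * T) * vhat s + g s * v s)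
    has_integral \<tau> * vhat t - sqrt Vmeas * wiener_int g g' bm t) {0..t}"
    using J0 J_eq[OF t] init by simp
  moreover have "(\<lambda>s. (- vhat s + R * (- G * vhat s)) - \<sigma> * Tmin s / (2 * T) * vhat s + g s * v s)
     = (\<lambda>s. - vhat s - R * G * vhat s + g s * (v s - vhat s))"
    by (auto simp: g_def right_diff_distrib)
  ultimately show ?thesis by simp
qed

lemma error_path_eq:
  assumes t: "0 \<le> t"
  shows "E t * (v t - vhat t) = error_path b bm x0 t"
proof -
  \<comment> \<open>The noise of the difference equation: driving noise minus the gain-weighted
    measurement noise that entered through the estimate.\<close>
  define n where "n = (\<lambda>t. \<beta> * b t + (- \<gamma>) * wiener_int g g' bm t)"
  have wc: "continuous_on {0..} (wiener_int g g' bm)" by (rule wiener_int_continuous[OF C1_g cont(5)])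
  have nc: "continuous_on {0..} n"
    unfolding n_def by (intro continuous_intros cont wc)
  have eq: "((\<lambda>s. - a s * (v s - vhat s) + 0) has_integral (v t - vhat t) - x0 - n t) {0..t}"
    if t: "0 \<le> t" for t
  proof -
    from has_integral_mult_right[OF has_integral_diff[OF dv[OF t] vhat_eq[OF t]], of "1 / \<tau>"]
    have "((\<lambda>s. 1 / \<tau> * (- v s + R * (- G * vhat s) - (- vhat s - R * G * vhat s + g s * (v s - vhat s))))
      has_integral 1 / \<tau> * (\<tau> * v t - \<tau> * v 0 - (sqrt (2 * k * T * R) * b t - sqrt (2 * k * T * R) * b 0) -
        (\<tau> * vhat t - sqrt Vmeas * wiener_int g g' bm t))) {0..t}" .
    moreover have "(\<lambda>s. 1 / \<tau> * (- v s + R * (- G * vhat s) - (- vhat s - R * G * vhat s + g s * (v s - vhat s))))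
       = (\<lambda>s. - a s * (v s - vhat s) + 0)"
      using \<tau>_pos by (auto simp: a_def field_simps)
    moreover have "1 / \<tau> * (\<tau> * v t - \<tau> * v 0 - (sqrt (2 * k * T * R) * b t - sqrt (2 * k * T * R) * b 0) -
        (\<tau> * vhat t - sqrt Vmeas * wiener_int g g' bm t)) = (v t - vhat t) - x0 - n t"
      using \<tau>_pos init by (simp add: n_def \<beta>_def \<gamma>_def field_simps)
    ultimately show ?thesis by simp
  qed
  have ec: "continuous_on {0..} (\<lambda>t. v t - vhat t)" by (intro continuous_intros cont)
  have "E t * (v t - vhat t) = x0 + integral {0..t} (\<lambda>s. E s * 0) + wiener_int E (\<lambda>t. a t * E t) n t"
    by (rule linear_ode_with_noise[OF C1_E[unfolded E'_def[abs_def]] E_0 a_continuous _ nc ec eq t]) auto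
  also have "wiener_int E (\<lambda>t. a t * E t) n t = wiener_int E E' n t" by (simp add: E'_def[abs_def])
  also have "\<dots> = \<beta> * wiener_int E E' b t + (- \<gamma>) * wiener_int E E' (wiener_int g g' bm) t"
    unfolding n_def by (rule wiener_int_linear_path[OF C1_E cont(4) wc])
  also have "wiener_int E E' (wiener_int g g' bm) t = wiener_int Eg Eg' bm t"
    unfolding wiener_int_mult[OF C1_E C1_g cont(5) t] by (simp add: Eg_def[abs_def] Eg'_def[abs_def])
  finally show ?thesis by (simp add: error_path_def)
qed

text \<open>\<open>F G * vhat\<close> contains the time integral of \<open>K' G\<close> times the
  error path. By parts this is a boundary term minus the Wiener integral of \<open>K G\<close>
  against the error path, whose own Wiener integrals are absorbed by \<open>wiener_int_mult\<close>.
  No nested integral remains.\<close>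

lemma estimate_path_eq:
  assumes t: "0 \<le> t"
  shows "F G t * vhat t = K G t * error_path b bm x0 t
     - \<beta> * wiener_int (KE G) (KE' G) b t + \<gamma> * wiener_int (KEg G) (KEg' G) bm t + \<gamma> * wiener_int (Fg G) (Fg' G) bm t"
proof -
  have wc: "continuous_on {0..} (wiener_int g g' bm)" by (rule wiener_int_continuous[OF C1_g cont(5)])
  have w1: "continuous_on {0..} (wiener_int E E' b)" by (rule wiener_int_continuous[OF C1_E cont(4)])
  have w2: "continuous_on {0..} (wiener_int Eg Eg' bm)" by (rule wiener_int_continuous[OF C1_Eg cont(5)])
  define q where "q = (\<lambda>s. g s / \<tau> * (v s - vhat s))"
  have qc: "continuous_on {0..} q"
    unfolding q_def using \<tau>_pos by (intro continuous_intros cont conts) auto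
  have eq: "((\<lambda>s. - c G * vhat s + q s) has_integral vhat t - 0 - \<gamma> * wiener_int g g' bm t) {0..t}"
    if t: "0 \<le> t" for t
  proof -
    from has_integral_mult_right[OF vhat_eq[OF t], of "1 / \<tau>"]
    have "((\<lambda>s. 1 / \<tau> * (- vhat s - R * G * vhat s + g s * (v s - vhat s))) has_integral
      1 / \<tau> * (\<tau> * vhat t - sqrt Vmeas * wiener_int g g' bm t)) {0..t}" .
    moreover have "(\<lambda>s. 1 / \<tau> * (- vhat s - R * G * vhat s + g s * (v s - vhat s))) = (\<lambda>s. - c G * vhat s + q s)"
      using \<tau>_pos by (auto simp: c_def q_def field_simps)
    moreover have "1 / \<tau> * (\<tau> * vhat t - sqrt Vmeas * wiener_int g g' bm t) = vhat t - 0 - \<gamma> * wiener_int g g' bm t"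
      using \<tau>_pos by (simp add: \<gamma>_def field_simps)
    ultimately show ?thesis by simp
  qed
  have "F G t * vhat t = 0 + integral {0..t} (\<lambda>s. F G s * q s) + wiener_int (F G) (\<lambda>t. c G * F G t) (\<lambda>t. \<gamma> * wiener_int g g' bm t) t"
    by (rule linear_ode_with_noise[OF C1_F[unfolded F'_def[abs_def]] F_0 _ qc _ cont(2) eq t])
      (auto intro!: continuous_intros wc)
  also have "wiener_int (F G) (\<lambda>t. c G * F G t) (\<lambda>t. \<gamma> * wiener_int g g' bm t) t = \<gamma> * wiener_int (F G) (F' G) (wiener_int g g' bm) t"
    using wiener_int_linear_path[OF C1_F wc wc, of G \<gamma> 0 t] by (simp add: F'_def[abs_def])
  also have "wiener_int (F G) (F' G) (wiener_int g g' bm) t = wiener_int (Fg G) (Fg' G) bm t"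
    unfolding wiener_int_mult[OF C1_F C1_g cont(5) t] by (simp add: Fg_def[abs_def] Fg'_def[abs_def])
  also have "integral {0..t} (\<lambda>s. F G s * q s) = integral {0..t} (\<lambda>s. K' G s * error_path b bm x0 s)"
  proof (rule Henstock_Kurzweil_Integration.integral_cong)
    fix s assume "s \<in> {0..t}"
    then have e: "error_path b bm x0 s = E s * (v s - vhat s)" using error_path_eq by simp
    show "F G s * q s = K' G s * error_path b bm x0 s"
      unfolding e K'_def q_def using \<tau>_pos E_pos[of s] by (simp add: divide_simps)
  qed
  also have "\<dots> = K G t * error_path b bm x0 t - wiener_int (K G) (K' G) (error_path b bm x0) t"
    by (simp add: wiener_int_def)
  also have "wiener_int (K G) (K' G) (error_path b bm x0) t
     = \<beta> * wiener_int (K G) (K' G) (wiener_int E E' b) t - \<gamma> * wiener_int (K G) (K' G) (wiener_int Eg Eg' bm) t"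
  proof -
    \<comment> \<open>The factors 1 give the shape of a two-term linear combination, so that
      \<open>wiener_int_linear_path\<close> applies twice.\<close>
    have e: "error_path b bm x0 = (\<lambda>s. 1 * (x0 * 1 + \<beta> * wiener_int E E' b s) + (- \<gamma>) * wiener_int Eg Eg' bm s)"
      by (auto simp: error_path_def)
    have "wiener_int (K G) (K' G) (error_path b bm x0) t
      = 1 * wiener_int (K G) (K' G) (\<lambda>s. x0 * 1 + \<beta> * wiener_int E E' b s) t + (- \<gamma>) * wiener_int (K G) (K' G) (wiener_int Eg Eg' bm) t"
      unfolding e by (rule wiener_int_linear_path[OF C1_K _ w2]) (intro continuous_intros w1)
    also have "wiener_int (K G) (K' G) (\<lambda>s. x0 * 1 + \<beta> * wiener_int E E' b s) t
      = x0 * wiener_int (K G) (K' G) (\<lambda>_. 1) t + \<beta> * wiener_int (K G) (K' G) (wiener_int E E' b) t"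
      by (rule wiener_int_linear_path[OF C1_K _ w1]) (intro continuous_intros)
    \<comment> \<open>A constant path has no increments and \<open>K G\<close> starts at 0; the
      initial voltage thus enters only through the boundary term
      \<open>K G t * error_path b bm x0 t\<close>.\<close>
    also have "wiener_int (K G) (K' G) (\<lambda>_. 1) t = 0" by (simp add: wiener_int_def K_def)
    finally show ?thesis by simp
  qed
  also have "wiener_int (K G) (K' G) (wiener_int E E' b) t = wiener_int (KE G) (KE' G) b t"
    unfolding wiener_int_mult[OF C1_K C1_E cont(4) t] by (simp add: KE_def[abs_def] KE'_def[abs_def])
  also have "wiener_int (K G) (K' G) (wiener_int Eg Eg' bm) t = wiener_int (KEg G) (KEg' G) bm t"
    unfolding wiener_int_mult[OF C1_K C1_Eg cont(5) t] by (simp add: KEg_def[abs_def] KEg'_def[abs_def])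
  finally show ?thesis by (simp add: algebra_simps)
qed

end

end

section \<open>Second moments\<close>

lemma (in prob_space) expectation_sum_mult_sum:
  assumes "\<And>i. i \<in> I \<Longrightarrow> sq_integrable M (x i)" "\<And>i. i \<in> I \<Longrightarrow> sq_integrable M (y i)"
  shows "expectation (\<lambda>\<omega>. (\<Sum>i\<in>I. x i \<omega>) * (\<Sum>j\<in>I. y j \<omega>))
     = (\<Sum>i\<in>I. \<Sum>j\<in>I. expectation (\<lambda>\<omega>. x i \<omega> * y j \<omega>))"
  using assms by (simp add: sum_product Bochner_Integration.integral_sum
      Bochner_Integration.integrable_sum sq_integrable_mult)

text \<open>Only the second-order structure of the sources is recorded: error and estimate are
  linear in them, so these covariances decide every moment in question.\<close>

locale independent_noise = prob_space +
  fixes v0 :: "'a \<Rightarrow> real" and b bm :: "real \<Rightarrow> 'a \<Rightarrow> real" and V0 :: real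
  assumes v0: "sq_integrable M v0" "expectation (\<lambda>\<omega>. (v0 \<omega>)\<^sup>2) = V0"
    and b: "L2_process M b" "\<And>s u. 0 \<le> s \<Longrightarrow> 0 \<le> u \<Longrightarrow> expectation (\<lambda>\<omega>. b s \<omega> * b u \<omega>) = min s u"
    and bm: "L2_process M bm" "\<And>s u. 0 \<le> s \<Longrightarrow> 0 \<le> u \<Longrightarrow> expectation (\<lambda>\<omega>. bm s \<omega> * bm u \<omega>) = min s u"
    and v0_b: "\<And>s. 0 \<le> s \<Longrightarrow> expectation (\<lambda>\<omega>. v0 \<omega> * b s \<omega>) = 0"
    and v0_bm: "\<And>s. 0 \<le> s \<Longrightarrow> expectation (\<lambda>\<omega>. v0 \<omega> * bm s \<omega>) = 0"
    and b_bm: "\<And>s u. 0 \<le> s \<Longrightarrow> 0 \<le> u \<Longrightarrow> expectation (\<lambda>\<omega>. b s \<omega> * bm u \<omega>) = 0"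
begin

definition lin :: "real \<Rightarrow> (real \<Rightarrow> real) \<Rightarrow> (real \<Rightarrow> real) \<Rightarrow> (real \<Rightarrow> real) \<Rightarrow> (real \<Rightarrow> real) \<Rightarrow> real \<Rightarrow> 'a \<Rightarrow> real" where
  "lin \<alpha> f f' h h' t \<omega> = \<alpha> * v0 \<omega> + wiener_int f f' (\<lambda>s. b s \<omega>) t + wiener_int h h' (\<lambda>s. bm s \<omega>) t"

lemma sq_integrable_lin:
  assumes "C1_halfline f f'" "C1_halfline h h'" "0 \<le> t"
  shows "sq_integrable M (lin \<alpha> f f' h h' t)"
  unfolding lin_def
  by (intro sq_integrable_add sq_integrable_cmult v0 sq_integrable_wiener_int[OF prob_space_axioms] b bm assms)

lemma expectation_mult_wiener_int_0:
  assumes X: "L2_process M X" and f: "C1_halfline f f'" and t: "0 \<le> t" and \<xi>: "sq_integrable M \<xi>"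
    and 0: "\<And>s. 0 \<le> s \<Longrightarrow> expectation (\<lambda>\<omega>. \<xi> \<omega> * X s \<omega>) = 0"
  shows "expectation (\<lambda>\<omega>. \<xi> \<omega> * wiener_int f f' (\<lambda>s. X s \<omega>) t) = 0"
proof -
  have "integral {0..t} (\<lambda>s. f' s * expectation (\<lambda>\<omega>. \<xi> \<omega> * X s \<omega>)) = integral {0..t} (\<lambda>s. 0)"
    by (rule Henstock_Kurzweil_Integration.integral_cong) (simp add: 0)
  then show ?thesis
    using expectation_mult_wiener_int[OF prob_space_axioms X f t \<xi>] 0[OF t] by simp
qed

text \<open>Of the nine products of sources, only the three of a source with itself survive: the
  variance of \<open>v0\<close> and two Ito isometries.\<close>

lemma expectation_lin_mult_lin:
  assumes f: "C1_halfline f f'" and h: "C1_halfline h h'"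
    and f2: "C1_halfline f2 f2'" and h2: "C1_halfline h2 h2'" and t: "0 \<le> t"
  shows "expectation (\<lambda>\<omega>. lin \<alpha> f f' h h' t \<omega> * lin \<alpha>2 f2 f2' h2 h2' t \<omega>)
     = \<alpha> * \<alpha>2 * V0 + integral {0..t} (\<lambda>s. f s * f2 s) + integral {0..t} (\<lambda>s. h s * h2 s)"
proof -
  note P = prob_space_axioms
  define x where "x = (\<lambda>i::nat. [\<lambda>\<omega>. \<alpha> * v0 \<omega>, \<lambda>\<omega>. wiener_int f f' (\<lambda>s. b s \<omega>) t, \<lambda>\<omega>. wiener_int h h' (\<lambda>s. bm s \<omega>) t] ! i)"
  define y where "y = (\<lambda>i::nat. [\<lambda>\<omega>. \<alpha>2 * v0 \<omega>, \<lambda>\<omega>. wiener_int f2 f2' (\<lambda>s. b s \<omega>) t, \<lambda>\<omega>. wiener_int h2 h2' (\<lambda>s. bm s \<omega>) t] ! i)"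
  have I: "{..<3::nat} = {0, 1, 2}" by auto
  have x: "sq_integrable M (x i)" if "i \<in> {..<3}" for i
    using that unfolding I x_def
    by (auto intro!: sq_integrable_cmult v0 sq_integrable_wiener_int[OF P] b bm f h t)
  have y: "sq_integrable M (y i)" if "i \<in> {..<3}" for i
    using that unfolding I y_def
    by (auto intro!: sq_integrable_cmult v0 sq_integrable_wiener_int[OF P] b bm f2 h2 t)
  have 1: "expectation (\<lambda>\<omega>. v0 \<omega> * wiener_int f2 f2' (\<lambda>s. b s \<omega>) t) = 0"
    by (rule expectation_mult_wiener_int_0[OF b(1) f2 t v0(1) v0_b])
  have 2: "expectation (\<lambda>\<omega>. v0 \<omega> * wiener_int h2 h2' (\<lambda>s. bm s \<omega>) t) = 0"
    by (rule expectation_mult_wiener_int_0[OF bm(1) h2 t v0(1) v0_bm])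
  have 3: "expectation (\<lambda>\<omega>. wiener_int f f' (\<lambda>s. b s \<omega>) t * v0 \<omega>) = 0"
    using expectation_mult_wiener_int_0[OF b(1) f t v0(1) v0_b] by (simp add: mult.commute)
  have 4: "expectation (\<lambda>\<omega>. wiener_int h h' (\<lambda>s. bm s \<omega>) t * v0 \<omega>) = 0"
    using expectation_mult_wiener_int_0[OF bm(1) h t v0(1) v0_bm] by (simp add: mult.commute)
  have 5: "expectation (\<lambda>\<omega>. wiener_int f f' (\<lambda>s. b s \<omega>) t * wiener_int f2 f2' (\<lambda>s. b s \<omega>) t) = integral {0..t} (\<lambda>s. f s * f2 s)"
    using wiener_int_covariance[OF P b(1) b(1) f f2 t, of 1] b(2) by simp
  have 6: "expectation (\<lambda>\<omega>. wiener_int h h' (\<lambda>s. bm s \<omega>) t * wiener_int h2 h2' (\<lambda>s. bm s \<omega>) t) = integral {0..t} (\<lambda>s. h s * h2 s)"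
    using wiener_int_covariance[OF P bm(1) bm(1) h h2 t, of 1] bm(2) by simp
  have 7: "expectation (\<lambda>\<omega>. wiener_int f f' (\<lambda>s. b s \<omega>) t * wiener_int h2 h2' (\<lambda>s. bm s \<omega>) t) = 0"
    using wiener_int_covariance[OF P b(1) bm(1) f h2 t, of 0] b_bm by simp
  have 8: "expectation (\<lambda>\<omega>. wiener_int h h' (\<lambda>s. bm s \<omega>) t * wiener_int f2 f2' (\<lambda>s. b s \<omega>) t) = 0"
    using wiener_int_covariance[OF P bm(1) b(1) h f2 t, of 0] b_bm by (simp add: mult.commute)
  have 9: "expectation (\<lambda>\<omega>. v0 \<omega> * v0 \<omega>) = V0"
    using v0(2) by (simp add: power2_eq_square)
  have "expectation (\<lambda>\<omega>. lin \<alpha> f f' h h' t \<omega> * lin \<alpha>2 f2 f2' h2 h2' t \<omega>)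
    = expectation (\<lambda>\<omega>. (\<Sum>i\<in>{..<3}. x i \<omega>) * (\<Sum>j\<in>{..<3}. y j \<omega>))"
    unfolding I by (simp add: lin_def x_def y_def add.assoc)
  also have "\<dots> = (\<Sum>i\<in>{..<3}. \<Sum>j\<in>{..<3}. expectation (\<lambda>\<omega>. x i \<omega> * y j \<omega>))"
    by (rule expectation_sum_mult_sum[OF x y])
  also have "\<dots> = \<alpha> * \<alpha>2 * V0 + integral {0..t} (\<lambda>s. f s * f2 s) + integral {0..t} (\<lambda>s. h s * h2 s)"
    unfolding I by (simp add: x_def y_def 9 5 6 7 8 mult.assoc[of \<alpha>] mult.left_commute[of _ \<alpha>2] 1 2 3 4)
  finally show ?thesis .
qed

end

section \<open>Kernel identities from the Riccati equation\<close>

context kalman_filter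
begin

text \<open>This is where the value of \<sigma> matters: it ties the gain to the error variance
  \<open>k * Tmin s / C\<close>, here divided by \<tau>.\<close>

lemma gamma_sq_g: "\<gamma>\<^sup>2 * g s = k * Tmin s / (C * \<tau>)"
  using R C T Vmeas unfolding \<gamma>_def g_def unfolding \<sigma>_def \<tau>_def
  by (simp add: power_divide) (simp add: power2_eq_square field_simps)

text \<open>Fluctuation-dissipation: this strength balances relaxation at rate 1/\<tau> so that the
  uncontrolled variance stays at \<open>k * T / C\<close>.\<close>

lemma beta_sq: "\<beta>\<^sup>2 = 2 * k * T / (C * \<tau>)"
  using R C T k unfolding \<beta>_def unfolding \<tau>_def
  by (simp add: power_divide) (simp add: power2_eq_square field_simps)

text \<open>\<open>p\<close> is the variance of \<open>E * (v - vhat)\<close>; that \<open>p'\<close> is its derivative is the Riccati equation.\<close>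

definition p :: "real \<Rightarrow> real" where "p t = k / C * Tmin t * (E t)\<^sup>2"
definition p' :: "real \<Rightarrow> real" where "p' t = \<beta>\<^sup>2 * (E t)\<^sup>2 + \<gamma>\<^sup>2 * (Eg t)\<^sup>2"

lemma C1_p: "C1_halfline p p'"
proof (rule C1_halfline_cong[OF C1_halfline_mult[OF C1_halfline_cmult[OF C1_Tmin, of "k / C"] C1_halfline_mult[OF C1_E C1_E]]])
  fix t :: real
  show "k / C * Tmin t * (E t * E t) = p t" by (simp add: p_def power2_eq_square)
  have "\<gamma>\<^sup>2 * (Eg t)\<^sup>2 = (\<gamma>\<^sup>2 * g t) * g t * (E t)\<^sup>2"
    by (simp add: Eg_def power2_eq_square)
  also have "\<dots> = k * Tmin t / (C * \<tau>) * g t * (E t)\<^sup>2" by (simp add: gamma_sq_g)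
  finally have p': "p' t = (2 * k * T / (C * \<tau>) + k * Tmin t / (C * \<tau>) * g t) * (E t)\<^sup>2"
    unfolding p'_def beta_sq by (simp add: distrib_right)
  have T': "Tmin' t = (2 * (T - Tmin t) - g t * Tmin t) / \<tau>"
    by (simp add: Tmin'_def g_def power2_eq_square)
  show "k / C * Tmin' t * (E t * E t) + k / C * Tmin t * (E' t * E t + E t * E' t) = p' t"
    unfolding p' T' E'_def a_def using C \<tau>_pos by (simp add: power2_eq_square field_simps)
qed

lemma p_0: "p 0 = k * T / C"
  by (simp add: p_def E_0 Tmin_0)

text \<open>The Kalman gain is exactly the one for which this holds; it makes error and estimate
  uncorrelated.\<close>

lemma K'_p: "K' G t * p t = \<gamma>\<^sup>2 * (Eg t * Fg G t)"
proof -
  have "\<gamma>\<^sup>2 * (Eg t * Fg G t) = (\<gamma>\<^sup>2 * g t) * (E t * (F G t * g t))"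
    by (simp add: Eg_def Fg_def)
  then show ?thesis
    unfolding gamma_sq_g K'_def p_def using C \<tau>_pos E_pos[of t] by (simp add: power2_eq_square field_simps)
qed

text \<open>\<open>Zb G t\<close> and \<open>Zm G t\<close> are the kernels of \<open>F G t * vhat t\<close> against the driving and the measurement
  noise.\<close>

definition Zb :: "real \<Rightarrow> real \<Rightarrow> real \<Rightarrow> real" where
  "Zb G t s = \<beta> * K G t * E s + (- \<beta>) * KE G s"
definition Zb' :: "real \<Rightarrow> real \<Rightarrow> real \<Rightarrow> real" where
  "Zb' G t s = \<beta> * K G t * E' s + (- \<beta>) * KE' G s"
definition Zm :: "real \<Rightarrow> real \<Rightarrow> real \<Rightarrow> real" where
  "Zm G t s = (- \<gamma> * K G t) * Eg s + 1 * (\<gamma> * KEg G s + \<gamma> * Fg G s)"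
definition Zm' :: "real \<Rightarrow> real \<Rightarrow> real \<Rightarrow> real" where
  "Zm' G t s = (- \<gamma> * K G t) * Eg' s + 1 * (\<gamma> * KEg' G s + \<gamma> * Fg' G s)"

lemma C1_Zb: "C1_halfline (Zb G t) (Zb' G t)"
  unfolding Zb_def[abs_def] Zb'_def[abs_def]
  by (intro C1_halfline_add C1_halfline_cmult C1_E C1_KE)

lemma C1_Zm: "C1_halfline (Zm G t) (Zm' G t)"
  unfolding Zm_def[abs_def] Zm'_def[abs_def]
  by (intro C1_halfline_add C1_halfline_cmult C1_Eg C1_KEg C1_Fg)

text \<open>Noise that enters the error at time \<open>s\<close> reaches \<open>vhat\<close> at time
  \<open>t\<close> through the coupling accumulated in between, \<open>K G t - K G s\<close>. This
  factor vanishes at \<open>s = t\<close>, which removes the upper boundary terms below. In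
  \<open>Zm_eq\<close> the measurement noise has a direct term \<open>Fg\<close> besides.\<close>

lemma Zb_eq: "Zb G t s = \<beta> * ((K G t - K G s) * E s)"
  by (simp add: Zb_def KE_def algebra_simps)

lemma Zm_eq: "Zm G t s = \<gamma> * (Fg G s - (K G t - K G s) * Eg s)"
  by (simp add: Zm_def KEg_def algebra_simps)

lemmas conts' = conts C1_halfline_continuous[OF C1_Eg] C1_halfline_continuous[OF C1_Fg]
  C1_halfline_continuous[OF C1_p] C1_halfline_continuous[OF C1_Zb] C1_halfline_continuous[OF C1_Zm]
  C1_halflineD(2)[OF C1_p]

lemma integral_error_error:
  assumes t: "0 \<le> t"
  shows "k * T / C + integral {0..t} (\<lambda>s. (\<beta> * E s) * (\<beta> * E s)) + integral {0..t} (\<lambda>s. (- \<gamma> * Eg s) * (- \<gamma> * Eg s)) = p t"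
proof -
  have "integral {0..t} (\<lambda>s. (\<beta> * E s) * (\<beta> * E s)) + integral {0..t} (\<lambda>s. (- \<gamma> * Eg s) * (- \<gamma> * Eg s))
    = integral {0..t} (\<lambda>s. (\<beta> * E s) * (\<beta> * E s) + (- \<gamma> * Eg s) * (- \<gamma> * Eg s))"
    by (intro Henstock_Kurzweil_Integration.integral_add[symmetric] integrable_on_halfline_Icc continuous_intros conts')
  also have "(\<lambda>s. (\<beta> * E s) * (\<beta> * E s) + (- \<gamma> * Eg s) * (- \<gamma> * Eg s)) = p'"
    by (auto simp: p'_def power2_eq_square)
  also have "integral {0..t} p' = p t - p 0"
    by (rule integral_unique[OF C1_halfline_FTC[OF C1_p t]])
  finally show ?thesis by (simp add: p_0)
qed

lemma C1_KK: "C1_halfline (\<lambda>s. K G t - K G s) (\<lambda>s. 0 - K' G s)"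
  by (intro C1_halfline_diff C1_halfline_const C1_K)

text \<open>By \<open>K'_p\<close> the combined integrand is the derivative of
  \<open>(K G t - K G s) * p s\<close>. It vanishes at \<open>s = t\<close>, and its value at 0
  cancels the contribution of the initial voltage.\<close>

lemma integral_error_estimate:
  assumes t: "0 \<le> t"
  shows "K G t * (k * T / C) + integral {0..t} (\<lambda>s. (\<beta> * E s) * Zb G t s) + integral {0..t} (\<lambda>s. (- \<gamma> * Eg s) * Zm G t s) = 0"
proof -
  have "integral {0..t} (\<lambda>s. (\<beta> * E s) * Zb G t s) + integral {0..t} (\<lambda>s. (- \<gamma> * Eg s) * Zm G t s)
    = integral {0..t} (\<lambda>s. (\<beta> * E s) * Zb G t s + (- \<gamma> * Eg s) * Zm G t s)"
    by (intro Henstock_Kurzweil_Integration.integral_add[symmetric] integrable_on_halfline_Icc continuous_intros conts')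
  also have "(\<lambda>s. (\<beta> * E s) * Zb G t s + (- \<gamma> * Eg s) * Zm G t s)
     = (\<lambda>s. (0 - K' G s) * p s + (K G t - K G s) * p' s)"
  proof
    fix s
    have "(0 - K' G s) * p s + (K G t - K G s) * p' s = (K G t - K G s) * p' s - K' G s * p s" by simp
    then show "(\<beta> * E s) * Zb G t s + (- \<gamma> * Eg s) * Zm G t s = (0 - K' G s) * p s + (K G t - K G s) * p' s"
      unfolding K'_p Zb_eq Zm_eq p'_def by (simp add: power2_eq_square algebra_simps)
  qed
  also have "integral {0..t} \<dots> = (K G t - K G t) * p t - (K G t - K G 0) * p 0"
    by (rule integral_unique[OF C1_halfline_FTC[OF C1_halfline_mult[OF C1_KK C1_p] t]])
  finally show ?thesis by (simp add: p_0 K_0)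
qed

text \<open>Splitting off the derivative of \<open>(K G t - K G s)\<^sup>2 * p s\<close>, whose
  boundary value at 0 cancels the initial variance, leaves only the direct measurement noise. The
  variance of \<open>vhat\<close> is therefore that of a linear equation driven by white noise of
  amplitude \<open>\<gamma> * g\<close>.\<close>

lemma integral_estimate_estimate:
  assumes t: "0 \<le> t"
  shows "K G t * K G t * (k * T / C) + integral {0..t} (\<lambda>s. Zb G t s * Zb G t s) + integral {0..t} (\<lambda>s. Zm G t s * Zm G t s)
    = integral {0..t} (\<lambda>s. \<gamma>\<^sup>2 * (Fg G s)\<^sup>2)"
proof -
  define D where "D = (\<lambda>s. K G t - K G s)"
  have D: "C1_halfline D (\<lambda>s. 0 - K' G s)" unfolding D_def by (rule C1_KK)
  have Dp: "C1_halfline (\<lambda>s. D s * (D s * p s)) (\<lambda>s. (0 - K' G s) * (D s * p s) + D s * ((0 - K' G s) * p s + D s * p' s))"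
    by (intro C1_halfline_mult D C1_p)
  have "integral {0..t} (\<lambda>s. Zb G t s * Zb G t s) + integral {0..t} (\<lambda>s. Zm G t s * Zm G t s)
    = integral {0..t} (\<lambda>s. Zb G t s * Zb G t s + Zm G t s * Zm G t s)"
    by (intro Henstock_Kurzweil_Integration.integral_add[symmetric] integrable_on_halfline_Icc continuous_intros conts')
  also have "(\<lambda>s. Zb G t s * Zb G t s + Zm G t s * Zm G t s)
     = (\<lambda>s. ((0 - K' G s) * (D s * p s) + D s * ((0 - K' G s) * p s + D s * p' s)) + \<gamma>\<^sup>2 * (Fg G s)\<^sup>2)"
  proof
    fix s
    have "(0 - K' G s) * (D s * p s) + D s * ((0 - K' G s) * p s + D s * p' s)
       = D s * D s * p' s - 2 * D s * (K' G s * p s)" by (simp add: algebra_simps)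
    then show "Zb G t s * Zb G t s + Zm G t s * Zm G t s
       = ((0 - K' G s) * (D s * p s) + D s * ((0 - K' G s) * p s + D s * p' s)) + \<gamma>\<^sup>2 * (Fg G s)\<^sup>2"
      unfolding K'_p Zb_eq Zm_eq p'_def D_def by (simp add: power2_eq_square algebra_simps)
  qed
  also have "integral {0..t} \<dots> = integral {0..t} (\<lambda>s. (0 - K' G s) * (D s * p s) + D s * ((0 - K' G s) * p s + D s * p' s))
     + integral {0..t} (\<lambda>s. \<gamma>\<^sup>2 * (Fg G s)\<^sup>2)"
    by (intro Henstock_Kurzweil_Integration.integral_add integrable_on_halfline_Icc continuous_intros conts'
        C1_halflineD(2)[OF Dp])
  also have "integral {0..t} (\<lambda>s. (0 - K' G s) * (D s * p s) + D s * ((0 - K' G s) * p s + D s * p' s))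
     = D t * (D t * p t) - D 0 * (D 0 * p 0)"
    by (rule integral_unique[OF C1_halfline_FTC[OF Dp t]])
  finally show ?thesis by (simp add: p_0 K_0 D_def)
qed

subsection \<open>The feedback limit\<close>

definition q :: "real \<Rightarrow> real" where "q s = \<gamma>\<^sup>2 * (g s)\<^sup>2"

definition Q :: "real \<Rightarrow> real \<Rightarrow> real" where
  "Q G t = integral {0..t} (\<lambda>s. \<gamma>\<^sup>2 * (Fg G s)\<^sup>2) / (F G t)\<^sup>2"

lemma q_continuous: "continuous_on {0..} q"
  unfolding q_def by (intro continuous_intros conts)

lemma q_nonneg: "0 \<le> q s"
  by (simp add: q_def)

lemma Q_eq: "Q G t = integral {0..t} (\<lambda>s. exp (2 * c G * (s - t)) * q s)"
proof -
  have "exp (2 * c G * (s - t)) * q s = inverse ((F G t)\<^sup>2) * (\<gamma>\<^sup>2 * (Fg G s)\<^sup>2)" for s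
  proof -
    have "exp (2 * c G * (s - t)) = (F G s)\<^sup>2 / (F G t)\<^sup>2"
      unfolding F_def by (simp add: exp_diff[symmetric] exp_of_nat_mult[symmetric] algebra_simps)
    then show ?thesis by (simp add: q_def Fg_def power_mult_distrib field_simps)
  qed
  then show ?thesis by (simp add: Q_def field_simps)
qed

lemma exp_q_integrable: "(\<lambda>s. exp (2 * c G * (s - t)) * q s) integrable_on {0..t}"
  by (intro integrable_on_halfline_Icc continuous_intros q_continuous)

lemma c_mono: "G \<le> H \<Longrightarrow> c G \<le> c H"
  unfolding c_def using R \<tau>_pos by (intro divide_right_mono) auto

lemma c_pos: "0 \<le> G \<Longrightarrow> 0 < c G"
  unfolding c_def using R \<tau>_pos by (intro divide_pos_pos) (auto intro: add_pos_nonneg)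

lemma Q_antimono:
  assumes "G \<le> H"
  shows "Q H t \<le> Q G t"
  unfolding Q_eq
proof (rule integral_le[OF exp_q_integrable exp_q_integrable])
  fix s assume "s \<in> {0..t}"
  then have "c H * (s - t) \<le> c G * (s - t)"
    using c_mono[OF assms] by (intro mult_right_mono_neg) auto
  then show "exp (2 * c H * (s - t)) * q s \<le> exp (2 * c G * (s - t)) * q s"
    using q_nonneg by (intro mult_right_mono) auto
qed

lemma Q_nonneg: "0 \<le> Q G t"
  unfolding Q_eq by (rule integral_nonneg[OF exp_q_integrable]) (simp add: q_nonneg)

text \<open>Pulling the factor \<open>exp (-2 * c G * t)\<close> out of the integral leaves an
  integrand free of \<open>t\<close>, so the product rule replaces differentiation under the
  integral sign.\<close>

lemma C1_Q: "C1_halfline (Q G) (\<lambda>t. q t - 2 * c G * Q G t)"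
proof -
  have "C1_halfline (\<lambda>t. (-2 * c G) * t) (\<lambda>_. -2 * c G)"
    by (auto simp: C1_halfline_def intro!: derivative_eq_intros)
  note e = C1_halfline_exp[OF this]
  have "C1_halfline (\<lambda>t. integral {0..t} (\<lambda>s. \<gamma>\<^sup>2 * (Fg G s)\<^sup>2)) (\<lambda>s. \<gamma>\<^sup>2 * (Fg G s)\<^sup>2)"
    by (intro C1_halfline_integral continuous_intros conts')
  note * = C1_halfline_mult[OF e this]
  have ee: "exp (- 2 * c G * t) = 1 / (F G t)\<^sup>2" for t
    unfolding F_def by (simp add: exp_minus field_simps exp_of_nat_mult[symmetric])
  show ?thesis
  proof (rule C1_halfline_cong[OF *])
    fix t
    show "exp (- 2 * c G * t) * integral {0..t} (\<lambda>s. \<gamma>\<^sup>2 * (Fg G s)\<^sup>2) = Q G t"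
      unfolding ee Q_def by simp
    have "1 / (F G t)\<^sup>2 * (\<gamma>\<^sup>2 * (Fg G t)\<^sup>2) = q t"
      using F_pos[of G t] by (simp add: q_def Fg_def power_mult_distrib)
    then show "- 2 * c G * exp (- 2 * c G * t) * integral {0..t} (\<lambda>s. \<gamma>\<^sup>2 * (Fg G s)\<^sup>2) +
         exp (- 2 * c G * t) * (\<gamma>\<^sup>2 * (Fg G t)\<^sup>2) = q t - 2 * c G * Q G t"
      unfolding ee by (simp add: Q_def)
  qed
qed

lemma integral_Q:
  assumes t: "0 \<le> t"
  shows "2 * c G * integral {0..t} (Q G) = integral {0..t} q - Q G t"
proof -
  have "integral {0..t} (\<lambda>s. q s - 2 * c G * Q G s) = Q G t - Q G 0"
    by (rule integral_unique[OF C1_halfline_FTC[OF C1_Q t]])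
  moreover have "integral {0..t} (\<lambda>s. q s - 2 * c G * Q G s) = integral {0..t} q - integral {0..t} (\<lambda>s. 2 * c G * Q G s)"
    by (intro Henstock_Kurzweil_Integration.integral_diff integrable_on_halfline_Icc continuous_intros
        q_continuous C1_halfline_continuous[OF C1_Q])
  moreover have "Q G 0 = 0" by (simp add: Q_def)
  ultimately show ?thesis by simp
qed

lemma c_at_top: "filterlim c at_top at_top"
proof -
  have "filterlim (\<lambda>G. 1 / \<tau> + (R / \<tau>) * G) at_top at_top"
    using R \<tau>_pos
    by (intro filterlim_tendsto_add_at_top[OF tendsto_const]
        filterlim_tendsto_pos_mult_at_top[OF tendsto_const] filterlim_ident) auto
  then show ?thesis by (simp add: c_def[abs_def] add_divide_distrib)
qed

lemma Q_tendsto_0: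
  assumes t: "0 \<le> t"
  shows "((\<lambda>G. Q G t) \<longlongrightarrow> 0) at_top"
proof -
  have "bounded (q ` {0..t})"
    by (intro compact_imp_bounded compact_continuous_image continuous_on_halfline_Icc q_continuous) auto
  then obtain B where "B > 0" "\<forall>x\<in>q ` {0..t}. norm x \<le> B"
    unfolding bounded_pos by blast
  then have B: "\<And>s. s \<in> {0..t} \<Longrightarrow> q s \<le> B" "B > 0" by (auto intro: order_trans[OF abs_ge_self])
  \<comment> \<open>With \<open>q\<close> replaced by its bound on the interval, the exponential has
    an explicit primitive and gives decay like the inverse of \<open>c G\<close>.\<close>
  have bound: "Q G t \<le> B / (2 * c G)" if G: "0 \<le> G" for G
  proof -
    note cp = c_pos[OF G]
    have "Q G t \<le> integral {0..t} (\<lambda>s. B * exp (2 * c G * (s - t)))"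
      unfolding Q_eq
      by (rule integral_le[OF exp_q_integrable])
        (use B in \<open>auto intro!: integrable_on_halfline_Icc continuous_intros simp: mult.commute\<close>)
    also have "\<dots> = B / (2 * c G) * exp (2 * c G * (t - t)) - B / (2 * c G) * exp (2 * c G * (0 - t))"
    proof (rule integral_unique[OF C1_halfline_FTC[OF _ t]])
      show "C1_halfline (\<lambda>s. B / (2 * c G) * exp (2 * c G * (s - t))) (\<lambda>s. B * exp (2 * c G * (s - t)))"
        using cp by (auto simp: C1_halfline_def intro!: derivative_eq_intros continuous_intros)
    qed
    also have "\<dots> \<le> B / (2 * c G)" using B(2) cp by simp
    finally show ?thesis .
  qed
  show ?thesis
  proof (rule tendsto_sandwich[of "\<lambda>_. 0" _ _ "\<lambda>G. B / (2 * c G)"])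
    show "\<forall>\<^sub>F G in at_top. Q G t \<le> B / (2 * c G)"
      using eventually_ge_at_top[of 0] by eventually_elim (rule bound)
    have "filterlim (\<lambda>G. 2 * c G) at_top at_top"
      by (intro filterlim_tendsto_pos_mult_at_top[OF tendsto_const] c_at_top) auto
    then show "((\<lambda>G. B / (2 * c G)) \<longlongrightarrow> 0) at_top"
      by (intro tendsto_divide_0[OF tendsto_const] filterlim_at_top_imp_at_infinity)
  qed (auto simp: Q_nonneg)
qed

text \<open>As \<open>c\<close> is affine in \<open>G\<close> with slope \<open>R / \<tau>\<close>,
  the prefactor \<open>G / (2 * c G)\<close> tends to \<open>\<tau> / (2 * R)\<close> while
  \<open>Q\<close> dies out; what remains is that multiple of the integral of \<open>q\<close>, to
  be recognized as the maximal work.\<close>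

lemma work_limit:
  assumes t: "0 \<le> t"
  shows "((\<lambda>G. G * integral {0..t} (Q G)) \<longlongrightarrow>
     integral {0..t} (\<lambda>s. k / \<tau> * (T - Tmin s)) + 1 / 2 * k * (T - Tmin t)) at_top"
proof -
  have "((\<lambda>G::real. G / (2 * c G)) \<longlongrightarrow> \<tau> / (2 * R)) at_top"
  proof -
    have "((\<lambda>G. \<tau> / (2 * (1 / G + R))) \<longlongrightarrow> \<tau> / (2 * (0 + R))) at_top"
      using R by (intro tendsto_intros tendsto_divide_0[OF tendsto_const]
          filterlim_at_top_imp_at_infinity filterlim_ident) auto
    moreover have "\<forall>\<^sub>F G in at_top. \<tau> / (2 * (1 / G + R)) = G / (2 * c G)"
      using eventually_gt_at_top[of 0]
    proof eventually_elim
      case (elim G)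
      then show ?case using R \<tau>_pos c_pos[of G] by (simp add: c_def field_simps)
    qed
    ultimately show ?thesis by (simp add: filterlim_cong)
  qed
  from tendsto_mult[OF this tendsto_diff[OF tendsto_const Q_tendsto_0[OF t], of "integral {0..t} q"]]
  have "((\<lambda>G. G / (2 * c G) * (integral {0..t} q - Q G t)) \<longlongrightarrow> \<tau> / (2 * R) * integral {0..t} q) at_top"
    by simp
  moreover have "\<forall>\<^sub>F G in at_top. G / (2 * c G) * (integral {0..t} q - Q G t) = G * integral {0..t} (Q G)"
    using eventually_ge_at_top[of 0]
  proof eventually_elim
    case (elim G)
    then show ?case using c_pos[of G] by (simp add: integral_Q[OF t, symmetric])
  qed
  ultimately have lim: "((\<lambda>G. G * integral {0..t} (Q G)) \<longlongrightarrow> \<tau> / (2 * R) * integral {0..t} q) at_top"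
    by (simp add: filterlim_cong)
  \<comment> \<open>The Riccati equation trades the quadratic term \<open>g s * Tmin s\<close> for
    the heat flow \<open>2 * (T - Tmin s)\<close> minus \<open>\<tau> * Tmin' s\<close>; the latter
    is exact and integrates to the boundary term of the work.\<close>
  have pt: "\<tau> / (2 * R) * q s = k / \<tau> * (T - Tmin s) - k / 2 * Tmin' s" for s
  proof -
    have "q s = (\<gamma>\<^sup>2 * g s) * g s" by (simp add: q_def power2_eq_square)
    also have "\<dots> = k * Tmin s / (C * \<tau>) * g s" by (simp add: gamma_sq_g)
    finally have q: "\<tau> / (2 * R) * q s = k * Tmin s * g s / (2 * \<tau>)"
      using R C \<tau>_pos by (simp add: \<tau>_def field_simps)
    have T': "Tmin' s = (2 * (T - Tmin s) - g s * Tmin s) / \<tau>"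
      by (simp add: Tmin'_def g_def power2_eq_square)
    show ?thesis unfolding q T' using \<tau>_pos by (simp add: field_simps)
  qed
  have "\<tau> / (2 * R) * integral {0..t} q = integral {0..t} (\<lambda>s. \<tau> / (2 * R) * q s)"
    by simp
  also have "\<dots> = integral {0..t} (\<lambda>s. k / \<tau> * (T - Tmin s) - k / 2 * Tmin' s)"
    by (simp only: pt)
  also have "\<dots> = integral {0..t} (\<lambda>s. k / \<tau> * (T - Tmin s)) - integral {0..t} (\<lambda>s. k / 2 * Tmin' s)"
    by (intro Henstock_Kurzweil_Integration.integral_diff integrable_on_halfline_Icc continuous_intros
        conts C1_halflineD(2)[OF C1_Tmin])
  also have "integral {0..t} (\<lambda>s. k / 2 * Tmin' s) = k / 2 * (Tmin t - T)"
    using integral_unique[OF C1_halfline_FTC[OF C1_Tmin t]] by (simp add: Tmin_0)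
  also have "integral {0..t} (\<lambda>s. k / \<tau> * (T - Tmin s)) - k / 2 * (Tmin t - T)
     = integral {0..t} (\<lambda>s. k / \<tau> * (T - Tmin s)) + 1 / 2 * k * (T - Tmin t)"
    by (simp add: algebra_simps diff_divide_distrib)
  finally show ?thesis using lim by (simp only:)
qed

end

section \<open>Moments of the voltage and of the extracted power\<close>

lemma wiener_int_cmult:
  assumes "C1_halfline f f'" "continuous_on {0..} x"
  shows "wiener_int (\<lambda>t. r * f t) (\<lambda>t. r * f' t) x t = r * wiener_int f f' x t"
  using wiener_int_linear_kernel[OF assms(1,1,2), of r 0 t] by simp

locale noisy_kalman_filter = kalman_filter R C T k Vmeas \<tau> \<sigma> Tmin
    + independent_noise M v0 b bm "k * T / C"
  for R C T k Vmeas \<tau> \<sigma> :: real and Tmin :: "real \<Rightarrow> real" and M :: "'a measure"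
    and v0 :: "'a \<Rightarrow> real" and b bm :: "real \<Rightarrow> 'a \<Rightarrow> real"
begin

text \<open>\<open>X\<close> and the following \<open>Z\<close> are the integrating factors times
  error and estimate, as linear functionals of the sources. The kernels of \<open>X\<close> contain
  neither \<open>G\<close> nor the final time; those of \<open>Z\<close> contain both.\<close>

definition X :: "real \<Rightarrow> 'a \<Rightarrow> real" where
  "X t = lin 1 (\<lambda>s. \<beta> * E s) (\<lambda>s. \<beta> * E' s) (\<lambda>s. - \<gamma> * Eg s) (\<lambda>s. - \<gamma> * Eg' s) t"

definition Z :: "real \<Rightarrow> real \<Rightarrow> 'a \<Rightarrow> real" where
  "Z G t = lin (K G t) (Zb G t) (Zb' G t) (Zm G t) (Zm' G t) t"

lemma b_continuous: "\<omega> \<in> space M \<Longrightarrow> continuous_on {0..} (\<lambda>s. b s \<omega>)"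
  using b(1) by (auto simp: L2_process_def)

lemma bm_continuous: "\<omega> \<in> space M \<Longrightarrow> continuous_on {0..} (\<lambda>s. bm s \<omega>)"
  using bm(1) by (auto simp: L2_process_def)

lemma error_path_X:
  assumes "\<omega> \<in> space M"
  shows "error_path (\<lambda>s. b s \<omega>) (\<lambda>s. bm s \<omega>) (v0 \<omega>) t = X t \<omega>"
  unfolding X_def lin_def error_path_def
    wiener_int_cmult[OF C1_E b_continuous[OF assms]] wiener_int_cmult[OF C1_Eg bm_continuous[OF assms]] by simp

lemma estimate_path_Z:
  assumes "\<omega> \<in> space M"
  shows "K G t * error_path (\<lambda>s. b s \<omega>) (\<lambda>s. bm s \<omega>) (v0 \<omega>) t
     - \<beta> * wiener_int (KE G) (KE' G) (\<lambda>s. b s \<omega>) t + \<gamma> * wiener_int (KEg G) (KEg' G) (\<lambda>s. bm s \<omega>) t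
     + \<gamma> * wiener_int (Fg G) (Fg' G) (\<lambda>s. bm s \<omega>) t = Z G t \<omega>"
  unfolding Z_def lin_def error_path_def Zb_def[abs_def] Zb'_def[abs_def] Zm_def[abs_def] Zm'_def[abs_def]
    wiener_int_linear_kernel[OF C1_E C1_KE b_continuous[OF assms]]
    wiener_int_linear_kernel[OF C1_Eg C1_halfline_add[OF C1_halfline_cmult[OF C1_KEg] C1_halfline_cmult[OF C1_Fg]] bm_continuous[OF assms]]
    wiener_int_linear_kernel[OF C1_KEg C1_Fg bm_continuous[OF assms]]
  by (simp add: algebra_simps)

lemma X_Z_moments:
  assumes t: "0 \<le> t"
  shows "sq_integrable M (X t)" "sq_integrable M (Z G t)"
    and "expectation (\<lambda>\<omega>. X t \<omega> * X t \<omega>) = p t"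
    and "expectation (\<lambda>\<omega>. X t \<omega> * Z G t \<omega>) = 0"
    and "expectation (\<lambda>\<omega>. Z G t \<omega> * Z G t \<omega>) = integral {0..t} (\<lambda>s. \<gamma>\<^sup>2 * (Fg G s)\<^sup>2)"
proof -
  note C1X = C1_halfline_cmult[OF C1_E, of \<beta>] C1_halfline_cmult[OF C1_Eg, of "- \<gamma>"]
  show "sq_integrable M (X t)" "sq_integrable M (Z G t)"
    unfolding X_def Z_def by (intro sq_integrable_lin C1X C1_Zb C1_Zm t)+
  show "expectation (\<lambda>\<omega>. X t \<omega> * X t \<omega>) = p t"
    unfolding X_def expectation_lin_mult_lin[OF C1X C1X t] using integral_error_error[OF t] by simp
  show "expectation (\<lambda>\<omega>. X t \<omega> * Z G t \<omega>) = 0"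
    unfolding X_def Z_def expectation_lin_mult_lin[OF C1X C1_Zb C1_Zm t]
    using integral_error_estimate[OF t, of G] by simp
  show "expectation (\<lambda>\<omega>. Z G t \<omega> * Z G t \<omega>) = integral {0..t} (\<lambda>s. \<gamma>\<^sup>2 * (Fg G s)\<^sup>2)"
    unfolding Z_def expectation_lin_mult_lin[OF C1_Zb C1_Zm C1_Zb C1_Zm t]
    using integral_estimate_estimate[OF t, of G] by simp
qed

text \<open>Here \<open>x\<close> and \<open>y\<close> stand for \<open>v\<close> and
  \<open>vhat\<close> at one time. Error and estimate are uncorrelated, so the variance of
  \<open>x\<close> splits into two parts and \<open>x * y\<close> has the same mean as
  \<open>y\<^sup>2\<close>.\<close>

lemma voltage_moments:
  assumes t: "0 \<le> t" and [measurable]: "x \<in> borel_measurable M" "y \<in> borel_measurable M"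
    and X: "AE \<omega> in M. E t * (x \<omega> - y \<omega>) = X t \<omega>" and Z: "AE \<omega> in M. F G t * y \<omega> = Z G t \<omega>"
  shows "integrable M (\<lambda>\<omega>. (x \<omega>)\<^sup>2)" "expectation (\<lambda>\<omega>. (x \<omega>)\<^sup>2) = k / C * Tmin t + Q G t"
    and "integrable M (\<lambda>\<omega>. x \<omega> * y \<omega>)" "expectation (\<lambda>\<omega>. x \<omega> * y \<omega>) = Q G t"
proof -
  note m = X_Z_moments[OF t]
  note [measurable] = m(1,2)[THEN sq_integrable_measurable]
  define e f where "e = 1 / E t" and "f = 1 / F G t"
  have y: "AE \<omega> in M. y \<omega> = f * Z G t \<omega>"
    using Z by eventually_elim (use F_pos[of G t] in \<open>auto simp: f_def field_simps\<close>)
  have x: "AE \<omega> in M. x \<omega> = e * X t \<omega> + f * Z G t \<omega>"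
    using X y by eventually_elim (use E_pos[of t] in \<open>auto simp: e_def field_simps\<close>)
  have i: "integrable M (\<lambda>\<omega>. X t \<omega> * X t \<omega>)" "integrable M (\<lambda>\<omega>. X t \<omega> * Z G t \<omega>)" "integrable M (\<lambda>\<omega>. Z G t \<omega> * Z G t \<omega>)"
    by (intro sq_integrable_mult m)+
  have ixx: "integrable M (\<lambda>\<omega>. e\<^sup>2 * (X t \<omega> * X t \<omega>) + 2 * e * f * (X t \<omega> * Z G t \<omega>) + f\<^sup>2 * (Z G t \<omega> * Z G t \<omega>))"
    and ixy: "integrable M (\<lambda>\<omega>. e * f * (X t \<omega> * Z G t \<omega>) + f\<^sup>2 * (Z G t \<omega> * Z G t \<omega>))"
    using i by auto
  have axx: "AE \<omega> in M. (x \<omega>)\<^sup>2 = e\<^sup>2 * (X t \<omega> * X t \<omega>) + 2 * e * f * (X t \<omega> * Z G t \<omega>) + f\<^sup>2 * (Z G t \<omega> * Z G t \<omega>)"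
    using x by eventually_elim (simp add: power2_eq_square algebra_simps)
  have axy: "AE \<omega> in M. x \<omega> * y \<omega> = e * f * (X t \<omega> * Z G t \<omega>) + f\<^sup>2 * (Z G t \<omega> * Z G t \<omega>)"
    using x y by eventually_elim (simp add: power2_eq_square algebra_simps)
  have fQ: "f\<^sup>2 * integral {0..t} (\<lambda>s. \<gamma>\<^sup>2 * (Fg G s)\<^sup>2) = Q G t"
    by (simp add: f_def Q_def power_divide)
  have ep: "e\<^sup>2 * p t = k / C * Tmin t"
    using E_pos[of t] by (simp add: e_def p_def power_divide)
  show "integrable M (\<lambda>\<omega>. (x \<omega>)\<^sup>2)"
    using ixx by (rule integrable_cong_AE_imp) (use axx in auto)
  show "integrable M (\<lambda>\<omega>. x \<omega> * y \<omega>)"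
    using ixy by (rule integrable_cong_AE_imp) (use axy in auto)
  have "expectation (\<lambda>\<omega>. (x \<omega>)\<^sup>2)
     = expectation (\<lambda>\<omega>. e\<^sup>2 * (X t \<omega> * X t \<omega>) + 2 * e * f * (X t \<omega> * Z G t \<omega>) + f\<^sup>2 * (Z G t \<omega> * Z G t \<omega>))"
    by (rule integral_cong_AE) (use axx in auto)
  also have "\<dots> = e\<^sup>2 * p t + f\<^sup>2 * integral {0..t} (\<lambda>s. \<gamma>\<^sup>2 * (Fg G s)\<^sup>2)"
    using i m(3,4,5) by simp
  finally show "expectation (\<lambda>\<omega>. (x \<omega>)\<^sup>2) = k / C * Tmin t + Q G t"
    unfolding fQ ep .
  have "expectation (\<lambda>\<omega>. x \<omega> * y \<omega>)
     = expectation (\<lambda>\<omega>. e * f * (X t \<omega> * Z G t \<omega>) + f\<^sup>2 * (Z G t \<omega> * Z G t \<omega>))"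
    by (rule integral_cong_AE) (use axy in auto)
  also have "\<dots> = f\<^sup>2 * integral {0..t} (\<lambda>s. \<gamma>\<^sup>2 * (Fg G s)\<^sup>2)"
    using i m(3,4,5) by simp
  finally show "expectation (\<lambda>\<omega>. x \<omega> * y \<omega>) = Q G t" unfolding fQ .
qed

end

section \<open>Verification of the noise assumptions and conclusion\<close>

lemma expectation_mult_cong_AE:
  fixes X X' Y Y' :: "'a \<Rightarrow> real"
  assumes "X \<in> borel_measurable M" "X' \<in> borel_measurable M" "Y \<in> borel_measurable M" "Y' \<in> borel_measurable M"
    and "AE \<omega> in M. X' \<omega> = X \<omega>" "AE \<omega> in M. Y' \<omega> = Y \<omega>"
  shows "(\<integral>\<omega>. X' \<omega> * Y' \<omega> \<partial>M) = (\<integral>\<omega>. X \<omega> * Y \<omega> \<partial>M)"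
  using assms by (intro integral_cong_AE borel_measurable_times) auto

text \<open>Each covariance is moved from the modification to the original process, where
  independence or the Brownian covariance decides it. The initial voltage is treated as a process
  constant in time.\<close>

lemma independent_noise_of_brownian:
  assumes M: "prob_space M" and pos: "0 < V0"
    and v0: "distributed M lborel v0 (normal_density 0 (sqrt V0))"
    and B: "brownian_motion M B" and Bm: "brownian_motion M Bmeas"
    and ind: "prob_space.indep_sets M
           (\<lambda>j. [process_algebra M (\<lambda>_. v0), process_algebra M B, process_algebra M Bmeas] ! j)
           {..<3::nat}"
    and b: "L2_process M b" "AE \<omega> in M. \<forall>t\<ge>0. b t \<omega> = B t \<omega>"
    and bm: "L2_process M bm" "AE \<omega> in M. \<forall>t\<ge>0. bm t \<omega> = Bmeas t \<omega>"
  shows "independent_noise M v0 b bm V0"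
proof -
  interpret prob_space M by fact
  note mv = normal_moments[OF _ v0]
  have sq0: "sq_integrable M v0" using mv pos by simp
  have ae: "AE \<omega> in M. b t \<omega> = B t \<omega>" "AE \<omega> in M. bm t \<omega> = Bmeas t \<omega>" if "0 \<le> t" for t
    using b(2) bm(2) that by auto
  have meas: "b t \<in> borel_measurable M" "bm t \<in> borel_measurable M"
    "B t \<in> borel_measurable M" "Bmeas t \<in> borel_measurable M" if "0 \<le> t" for t
    using that b(1) bm(1) brownian_moments(1)[OF B that] brownian_moments(1)[OF Bm that]
    by (auto simp: L2_process_def sq_integrable_def)
  have i0: "integrable M v0" by (rule sq_integrable_integrable[OF sq0])
  have iB: "integrable M (B t)" "integrable M (Bmeas t)" if "0 \<le> t" for t
    using sq_integrable_integrable brownian_moments(1)[OF B that] brownian_moments(1)[OF Bm that] by auto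
  show ?thesis
  proof (unfold_locales)
    show "sq_integrable M v0" by fact
    show "expectation (\<lambda>\<omega>. (v0 \<omega>)\<^sup>2) = V0" using mv pos by simp
    show "L2_process M b" "L2_process M bm" by fact+
    fix s :: real assume s: "0 \<le> s"
    have "expectation (\<lambda>\<omega>. v0 \<omega> * b s \<omega>) = expectation (\<lambda>\<omega>. v0 \<omega> * B s \<omega>)"
      using ae[OF s] meas[OF s] sq0 by (intro expectation_mult_cong_AE) auto
    also have "\<dots> = 0"
      using uncorrelated_of_indep_process_algebra[OF ind, of 0 1 "\<lambda>_. v0" B s s] s i0 iB[OF s]
        brownian_moments(2)[OF B s] by simp
    finally show "expectation (\<lambda>\<omega>. v0 \<omega> * b s \<omega>) = 0" .
    have "expectation (\<lambda>\<omega>. v0 \<omega> * bm s \<omega>) = expectation (\<lambda>\<omega>. v0 \<omega> * Bmeas s \<omega>)"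
      using ae[OF s] meas[OF s] sq0 by (intro expectation_mult_cong_AE) auto
    also have "\<dots> = 0"
      using uncorrelated_of_indep_process_algebra[OF ind, of 0 2 "\<lambda>_. v0" Bmeas s s] s i0 iB[OF s]
        brownian_moments(2)[OF Bm s] by simp
    finally show "expectation (\<lambda>\<omega>. v0 \<omega> * bm s \<omega>) = 0" .
    fix u :: real assume u: "0 \<le> u"
    have "expectation (\<lambda>\<omega>. b s \<omega> * b u \<omega>) = expectation (\<lambda>\<omega>. B s \<omega> * B u \<omega>)"
      using ae[OF s] ae[OF u] meas[OF s] meas[OF u] by (intro expectation_mult_cong_AE) auto
    then show "expectation (\<lambda>\<omega>. b s \<omega> * b u \<omega>) = min s u"
      using brownian_covariance[OF B s u] by simp
    have "expectation (\<lambda>\<omega>. bm s \<omega> * bm u \<omega>) = expectation (\<lambda>\<omega>. Bmeas s \<omega> * Bmeas u \<omega>)"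
      using ae[OF s] ae[OF u] meas[OF s] meas[OF u] by (intro expectation_mult_cong_AE) auto
    then show "expectation (\<lambda>\<omega>. bm s \<omega> * bm u \<omega>) = min s u"
      using brownian_covariance[OF Bm s u] by simp
    have "expectation (\<lambda>\<omega>. b s \<omega> * bm u \<omega>) = expectation (\<lambda>\<omega>. B s \<omega> * Bmeas u \<omega>)"
      using ae[OF s] ae[OF u] meas[OF s] meas[OF u] by (intro expectation_mult_cong_AE) auto
    also have "\<dots> = 0"
      using uncorrelated_of_indep_process_algebra[OF ind, of 1 2 B Bmeas s u] s u iB[OF s] iB[OF u]
        brownian_moments(2)[OF Bm u] by simp
    finally show "expectation (\<lambda>\<omega>. b s \<omega> * bm u \<omega>) = 0" .
  qed
qed

theorem mainTheorem3:
  fixes M :: "'a measure"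
    and R C T k Vmeas \<tau> \<sigma> :: real
    and v0 :: "'a \<Rightarrow> real"
    and B Bmeas :: "real \<Rightarrow> 'a \<Rightarrow> real"
    and Tmin :: "real \<Rightarrow> real"
    and v Y vhat i :: "real \<Rightarrow> real \<Rightarrow> 'a \<Rightarrow> real"
    and TC W :: "real \<Rightarrow> real \<Rightarrow> real"
    and Wmax :: "real \<Rightarrow> real"
  assumes "prob_space M"
    and "R > 0" "C > 0" "T > 0" "k > 0" "Vmeas > 0"
    and "\<tau> = R * C"
    and "\<sigma> = 2 * k * T * R / Vmeas"
    and "distributed M lborel v0 (normal_density 0 (sqrt (k * T / C)))"
    and "brownian_motion M B"
    and "brownian_motion M Bmeas"
    and "prob_space.indep_sets M
           (\<lambda>j. [process_algebra M (\<lambda>_. v0), process_algebra M B, process_algebra M Bmeas] ! j)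
           {..<3::nat}"
    and "\<And>t. t \<ge> 0 \<Longrightarrow>
           (Tmin has_real_derivative
              (2 * (T - Tmin t) - \<sigma> * (Tmin t)\<^sup>2 / (2 * T)) / \<tau>) (at t within {0..})"
    and "Tmin 0 = T"
    and "\<And>G. G \<ge> 0 \<Longrightarrow>
           stochastic_diff M (\<lambda>t \<omega>. \<tau> * v G t \<omega>) (\<lambda>t \<omega>. - v G t \<omega> + R * i G t \<omega>)
             (\<lambda>t \<omega>. sqrt (2 * k * T * R) * B t \<omega>)"
    and "\<And>G. G \<ge> 0 \<Longrightarrow> AE \<omega> in M. v G 0 \<omega> = v0 \<omega>"
    and "\<And>G. G \<ge> 0 \<Longrightarrow>
           stochastic_diff M (Y G) (\<lambda>t \<omega>. v G t \<omega> / sqrt Vmeas) Bmeas"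
    and "\<And>G. G \<ge> 0 \<Longrightarrow> AE \<omega> in M. Y G 0 \<omega> = 0"
    and "\<And>G. G \<ge> 0 \<Longrightarrow>
           \<exists>J. stochastic_integral M (\<lambda>t. \<sigma> * Tmin t / (2 * T) * sqrt Vmeas) (Y G) J \<and>
               stochastic_diff M (\<lambda>t \<omega>. \<tau> * vhat G t \<omega>)
                 (\<lambda>t \<omega>. (- vhat G t \<omega> + R * i G t \<omega>) - \<sigma> * Tmin t / (2 * T) * vhat G t \<omega>) J"
    and "\<And>G. G \<ge> 0 \<Longrightarrow> AE \<omega> in M. vhat G 0 \<omega> = 0"
    and "\<And>G t \<omega>. i G t \<omega> = - G * vhat G t \<omega>"
    and "\<And>G t. TC G t = C / k * (\<integral>\<omega>. (v G t \<omega>)\<^sup>2 \<partial>M)"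
    and "\<And>G t. W G t = - integral {0..t} (\<lambda>t'. \<integral>\<omega>. v G t' \<omega> * i G t' \<omega> \<partial>M)"
    and "\<And>t. Wmax t = integral {0..t} (\<lambda>t'. k / \<tau> * (T - Tmin t')) + 1 / 2 * k * (T - Tmin t)"
  shows "\<forall>t\<ge>0.
     (\<forall>G\<ge>0. integrable M (\<lambda>\<omega>. (v G t \<omega>)\<^sup>2) \<and>
            integrable M (\<lambda>\<omega>. v G t \<omega> * i G t \<omega>) \<and>
            (\<lambda>t'. \<integral>\<omega>. v G t' \<omega> * i G t' \<omega> \<partial>M) integrable_on {0..t}) \<and>
     antimono_on {0..} (\<lambda>G. TC G t) \<and>
     ((\<lambda>G. TC G t) \<longlongrightarrow> Tmin t) at_top \<and>
     ((\<lambda>G. W G t) \<longlongrightarrow> Wmax t) at_top"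
proof -
  interpret prob_space M by fact
  note pos = assms(2-6)
  have \<tau>: "\<tau> > 0" using pos assms(7) by simp
  obtain b where bB: "L2_process M b" "AE \<omega> in M. \<forall>t\<ge>0. b t \<omega> = B t \<omega>"
    using brownian_L2_modification[OF assms(10)] by blast
  obtain bm where bmB: "L2_process M bm" "AE \<omega> in M. \<forall>t\<ge>0. bm t \<omega> = Bmeas t \<omega>"
    using brownian_L2_modification[OF assms(11)] by blast
  interpret kalman_filter R C T k Vmeas \<tau> \<sigma> Tmin
    by unfold_locales (use assms(2-8,13,14) in auto)
  interpret independent_noise M v0 b bm "k * T / C"
    by (rule independent_noise_of_brownian[OF assms(1) _ assms(9-12) bB bmB]) (use pos in simp)
  interpret noisy_kalman_filter R C T k Vmeas \<tau> \<sigma> Tmin M v0 b bm ..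
  have B0: "AE \<omega> in M. B 0 \<omega> = 0" "AE \<omega> in M. Bmeas 0 \<omega> = 0"
    using assms(10,11) by (auto simp: brownian_motion_def)
  \<comment> \<open>The differential equations speak of the processes multiplied by \<tau>, so the
    factor has to be divided out.\<close>
  have meas: "v G t \<in> borel_measurable M" "vhat G t \<in> borel_measurable M"
    if "0 \<le> G" "0 \<le> t" for G t
  proof -
    have "(\<lambda>\<omega>. \<tau> * v G t \<omega>) \<in> borel_measurable M" "(\<lambda>\<omega>. \<tau> * vhat G t \<omega>) \<in> borel_measurable M"
      using assms(15)[OF that(1)] assms(19)[OF that(1)] that(2) by (auto simp: stochastic_diff_def)
    then have "(\<lambda>\<omega>. 1 / \<tau> * (\<tau> * v G t \<omega>)) \<in> borel_measurable M"
      "(\<lambda>\<omega>. 1 / \<tau> * (\<tau> * vhat G t \<omega>)) \<in> borel_measurable M"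
      using borel_measurable_times[OF borel_measurable_const] by blast+
    then show "v G t \<in> borel_measurable M" "vhat G t \<in> borel_measurable M"
      using \<tau> by simp_all
  qed
  \<comment> \<open>All almost sure properties are gathered on one null set; outside it the
    deterministic path lemmas apply for all times at once. The null set may vary with
    \<open>G\<close>, as every moment involves a single \<open>G\<close>.\<close>
  have paths: "AE \<omega> in M. \<forall>t\<ge>0. E t * (v G t \<omega> - vhat G t \<omega>) = X t \<omega> \<and> F G t * vhat G t \<omega> = Z G t \<omega>"
    if G: "0 \<le> G" for G
  proof -
    obtain J where J: "stochastic_integral M (\<lambda>t. \<sigma> * Tmin t / (2 * T) * sqrt Vmeas) (Y G) J"
      and dvhat: "stochastic_diff M (\<lambda>t \<omega>. \<tau> * vhat G t \<omega>)
        (\<lambda>t \<omega>. (- vhat G t \<omega> + R * i G t \<omega>) - \<sigma> * Tmin t / (2 * T) * vhat G t \<omega>) J"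
      using assms(19)[OF G] by blast
    have h: "(\<lambda>t. \<sigma> * Tmin t / (2 * T) * sqrt Vmeas) = (\<lambda>t. sqrt Vmeas * g t)"
      by (auto simp: g_def)
    have Y: "\<And>t. 0 \<le> t \<Longrightarrow> Y G t \<in> borel_measurable M" "AE \<omega> in M. continuous_on {0..} (\<lambda>t. Y G t \<omega>)"
      using assms(17)[OF G] by (auto simp: stochastic_diff_def)
    have Jeq: "AE \<omega> in M. \<forall>t\<ge>0. J t \<omega> =
        wiener_int (\<lambda>t. sqrt Vmeas * g t) (\<lambda>t. sqrt Vmeas * g' t) (\<lambda>s. Y G s \<omega>) t - sqrt Vmeas * g 0 * Y G 0 \<omega>"
      by (rule stochastic_integral_C1[OF assms(1) J[unfolded h] C1_halfline_cmult[OF C1_g] Y])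
    note v1 = assms(15)[OF G, unfolded stochastic_diff_def, THEN conjunct2, THEN conjunct1]
      and v2 = assms(15)[OF G, unfolded stochastic_diff_def, THEN conjunct2, THEN conjunct2]
      and Y2 = assms(17)[OF G, unfolded stochastic_diff_def, THEN conjunct2, THEN conjunct2]
      and h1 = dvhat[unfolded stochastic_diff_def, THEN conjunct2, THEN conjunct1]
      and h2 = dvhat[unfolded stochastic_diff_def, THEN conjunct2, THEN conjunct2]
    show ?thesis
      using v1 v2 Y(2) Y2 h1 h2 Jeq bB(2) bmB(2) B0 assms(16)[OF G] assms(18)[OF G] assms(20)[OF G] AE_space
    proof eventually_elim
      case (elim \<omega>)
      have cv: "continuous_on {0..} (\<lambda>t. 1 / \<tau> * (\<tau> * v G t \<omega>))"
        "continuous_on {0..} (\<lambda>t. 1 / \<tau> * (\<tau> * vhat G t \<omega>))"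
        by (rule continuous_on_mult_left[OF elim(1)], rule continuous_on_mult_left[OF elim(5)])
      have cont: "continuous_on {0..} (\<lambda>t. v G t \<omega>)" "continuous_on {0..} (\<lambda>t. vhat G t \<omega>)"
        using cv \<tau> by simp_all
      note b_eq = elim(8)[rule_format] and bm_eq = elim(9)[rule_format]
      have dv: "((\<lambda>s. - v G s \<omega> + R * (- G * vhat G s \<omega>)) has_integral
        (\<tau> * v G t \<omega> - \<tau> * v G 0 \<omega>) - (sqrt (2 * k * T * R) * b t \<omega> - sqrt (2 * k * T * R) * b 0 \<omega>)) {0..t}"
        if "0 \<le> t" for t
        using elim(2) that by (simp add: assms(21) b_eq)
      have dY: "((\<lambda>s. v G s \<omega> / sqrt Vmeas) has_integral (Y G t \<omega> - Y G 0 \<omega>) - (bm t \<omega> - bm 0 \<omega>)) {0..t}"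
        if "0 \<le> t" for t
        using elim(4) that by (simp add: bm_eq)
      have dvhat: "((\<lambda>s. (- vhat G s \<omega> + R * (- G * vhat G s \<omega>)) - \<sigma> * Tmin s / (2 * T) * vhat G s \<omega>)
        has_integral (\<tau> * vhat G t \<omega> - \<tau> * vhat G 0 \<omega>) - (J t \<omega> - J 0 \<omega>)) {0..t}"
        if "0 \<le> t" for t
        using elim(6) that by (simp add: assms(21))
      have "b 0 \<omega> = 0" "bm 0 \<omega> = 0" using elim(10,11) b_eq[of 0] bm_eq[of 0] by auto
      note init = elim(12,14,13) this
      note c = cont elim(3) b_continuous[OF elim(15)] bm_continuous[OF elim(15)]
      show ?case
        using error_path_eq[OF c init dv dY dvhat elim(7)[rule_format]]
          estimate_path_eq[OF c init dv dY dvhat elim(7)[rule_format]]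
          error_path_X[OF elim(15)] estimate_path_Z[OF elim(15)] by simp
    qed
  qed
  have mom: "integrable M (\<lambda>\<omega>. (v G t \<omega>)\<^sup>2)" "expectation (\<lambda>\<omega>. (v G t \<omega>)\<^sup>2) = k / C * Tmin t + Q G t"
    "integrable M (\<lambda>\<omega>. v G t \<omega> * i G t \<omega>)" "expectation (\<lambda>\<omega>. v G t \<omega> * i G t \<omega>) = - G * Q G t"
    if G: "0 \<le> G" and t: "0 \<le> t" for G t
  proof -
    have "AE \<omega> in M. E t * (v G t \<omega> - vhat G t \<omega>) = X t \<omega>" "AE \<omega> in M. F G t * vhat G t \<omega> = Z G t \<omega>"
      using paths[OF G] t by auto
    note m = voltage_moments[OF t meas[OF G t] this]
    show "integrable M (\<lambda>\<omega>. (v G t \<omega>)\<^sup>2)" "expectation (\<lambda>\<omega>. (v G t \<omega>)\<^sup>2) = k / C * Tmin t + Q G t"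
      by (fact m)+
    have vi: "(\<lambda>\<omega>. v G t \<omega> * i G t \<omega>) = (\<lambda>\<omega>. - G * (v G t \<omega> * vhat G t \<omega>))"
      by (auto simp: assms(21))
    show "integrable M (\<lambda>\<omega>. v G t \<omega> * i G t \<omega>)" "expectation (\<lambda>\<omega>. v G t \<omega> * i G t \<omega>) = - G * Q G t"
      unfolding vi using m(3,4) by simp_all
  qed
  have TC: "TC G t = Tmin t + C / k * Q G t" if "0 \<le> G" "0 \<le> t" for G t
    unfolding assms(22) mom(2)[OF that] using pos by (simp add: distrib_left)
  have power: "((\<lambda>t'. \<integral>\<omega>. v G t' \<omega> * i G t' \<omega> \<partial>M) has_integral - G * integral {0..t} (Q G)) {0..t}"
    if G: "0 \<le> G" for G t
  proof (rule has_integral_eq[rotated])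
    show "((\<lambda>s. - G * Q G s) has_integral - G * integral {0..t} (Q G)) {0..t}"
      by (intro has_integral_mult_right integrable_integral integrable_on_halfline_Icc
          C1_halfline_continuous[OF C1_Q])
  qed (simp add: mom(4)[OF G])
  have W: "W G t = G * integral {0..t} (Q G)" if "0 \<le> G" for G t
    unfolding assms(23) integral_unique[OF power[OF that]] by simp
  show ?thesis
  proof (intro allI impI conjI)
    fix t G :: real assume t: "0 \<le> t" and G: "0 \<le> G"
    show "integrable M (\<lambda>\<omega>. (v G t \<omega>)\<^sup>2)" "integrable M (\<lambda>\<omega>. v G t \<omega> * i G t \<omega>)"
      by (fact mom(1,3)[OF G t])+
    show "(\<lambda>t'. \<integral>\<omega>. v G t' \<omega> * i G t' \<omega> \<partial>M) integrable_on {0..t}"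
      using power[OF G] by blast
  next
    fix t :: real assume t: "0 \<le> t"
    show "antimono_on {0..} (\<lambda>G. TC G t)"
    proof (rule monotone_onI)
      fix G H :: real assume "G \<in> {0..}" "H \<in> {0..}" "G \<le> H"
      then show "TC H t \<le> TC G t"
        using Q_antimono[of G H t] pos t by (simp add: TC divide_right_mono mult_left_mono)
    qed
    \<comment> \<open>The formulas for \<open>TC\<close> and \<open>W\<close> are available for
      nonnegative gains, which suffices for limits at infinity.\<close>
    have ev: "\<forall>\<^sub>F G in at_top. (0::real) \<le> G" by (rule eventually_ge_at_top)
    have "((\<lambda>G. Tmin t + C / k * Q G t) \<longlongrightarrow> Tmin t + C / k * 0) at_top"
      by (intro tendsto_intros Q_tendsto_0[OF t])
    moreover have "\<forall>\<^sub>F G in at_top. Tmin t + C / k * Q G t = TC G t"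
      using ev by eventually_elim (simp add: TC t)
    ultimately show "((\<lambda>G. TC G t) \<longlongrightarrow> Tmin t) at_top"
      by (simp add: filterlim_cong)
    have "\<forall>\<^sub>F G in at_top. G * integral {0..t} (Q G) = W G t"
      using ev by eventually_elim (simp add: W)
    with work_limit[OF t] show "((\<lambda>G. W G t) \<longlongrightarrow> Wmax t) at_top"
      unfolding assms(24) by (simp add: filterlim_cong)
  qed
qed

end
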